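(* Let $n\ge1$. For $0\le i<j\le 2n-1$, $$g_n(i,j)=\begin{cases}1-g_n^{\mathbf b}(j) & \text{if } i=0,\ j>0,\\[2pt] \dfrac{Z_{n-1}}{Z_n}\,g_{n-1}^{\mathbf b}(j-2) & \text{if } i=1,\ j>1,\\[4pt] g_{n-1}(i-2,j-2)-g_n^{\mathbf b}(j)\,g_{n-1}^{\mathbf b}(i-2)+g_n^{\mathbf b}(i)\,g_{n-1}^{\mathbf b}(j-2) & \text{if } i,j\ge 2.\end{cases}$$
   Context: Notation: $[x]_2\in\{0,1\}$ is $x \bmod 2$. For $n\ge0$, $G_n=(\mathtt V_n,\mathtt E_n)$ is the graph with $\mathtt V_n=\{(x_1,x_2)\in\mathbb Z^2: 0\le x_1\le 2n,\ x_1\le x_2\le 2n+1\}$, with the vertex $(2n,2n+1)$ removed when $n$ is odd, and $\mathtt E_n$ consists of - the edges $\{(x_1,x_2),(x_1+1,x_2)\}$ with $0\le x_1\le 2n-1$, $x_1\le x_2\le 2n+1$, $[x_1+x_2]_2=1$; - the edges $\{(x_1,x_2),(x_1,x_2+1)\}$ with $0\le x_1\le 2n-[n]_2$, $x_1\le x_2\le 2n$; - the edges $\{(x_1,x_1),(x_1+1,x_1+1)\}$ with $0\le x_1\le 2n-1$. $Z_n$ is the number of perfect matchings of $G_n$ (it is positive), and $Z_n^{\{v_1,\dots,v_m\}}$ is the number of perfect matchings of the subgraph of $G_n$ induced on $\mathtt V_n\setminus\{v_1,\dots,v_m\}$. In quantities indexed by $n$, $\mathbf b$ denotes the vertex $(2n,2n+1-[n]_2)$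 of $G_n$. For $0\le j\le 2n-1$ let $$g_n^{\mathbf b}(j)=\frac{Z_n^{\{(j,j),\mathbf b\}}}{Z_n},$$ and for $0\le i<j\le 2n-1$ let $g_n(i,j)=Z_n^{\{(i,i),(j,j)\}}/Z_n$, with $g_n(j,i)=-g_n(i,j)$ and $g_n(i,i)=0$. (These are the absolute values of the entries $K_n^{-1}((j,j),\mathbf b)$ and $K_n^{-1}((i,i),(j,j))$ of the inverse Kasteleyn matrix.) *)

theory Defs
  imports Complex_Main
begin

text \<open>A finite simple graph is a pair of a vertex set and a set of two-element edges.\<close>

type_synonym 'a graph = "'a set \<times> 'a set set"

definition induced_subgraph :: "'a graph \<Rightarrow> 'a set \<Rightarrow> 'a graph" where
  "induced_subgraph H W = (fst H \<inter> W, {e \<in> snd H. e \<subseteq> W})"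

definition perfect_matching :: "'a graph \<Rightarrow> 'a set set \<Rightarrow> bool" where
  "perfect_matching H M \<longleftrightarrow> M \<subseteq> snd H \<and> (\<forall>v \<in> fst H. \<exists>!e. e \<in> M \<and> v \<in> e)"

definition num_perfect_matchings :: "'a graph \<Rightarrow> nat" where
  "num_perfect_matchings H = card {M. perfect_matching H M}"

definition VV :: "nat \<Rightarrow> (int \<times> int) set" where
  "VV n = {(x1, x2). 0 \<le> x1 \<and> x1 \<le> 2 * int n \<and> x1 \<le> x2 \<and> x2 \<le> 2 * int n + 1}
     - (if odd n then {(2 * int n, 2 * int n + 1)} else {})"

definition EE :: "nat \<Rightarrow> (int \<times> int) set set" where
  "EE n =
     {{(x1, x2), (x1 + 1, x2)} | x1 x2.
        0 \<le> x1 \<and> x1 \<le> 2 * int n - 1 \<and> x1 \<le> x2 \<and> x2 \<le> 2 * int n + 1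
        \<and> (x1 + x2) mod 2 = 1}
   \<union> {{(x1, x2), (x1, x2 + 1)} | x1 x2.
        0 \<le> x1 \<and> x1 \<le> 2 * int n - int n mod 2 \<and> x1 \<le> x2 \<and> x2 \<le> 2 * int n}
   \<union> {{(x1, x1), (x1 + 1, x1 + 1)} | x1. 0 \<le> x1 \<and> x1 \<le> 2 * int n - 1}"

definition GG :: "nat \<Rightarrow> (int \<times> int) graph" where
  "GG n = (VV n, EE n)"

definition Z :: "nat \<Rightarrow> nat" where
  "Z n = num_perfect_matchings (GG n)"

definition Z_del :: "nat \<Rightarrow> (int \<times> int) set \<Rightarrow> nat" where
  "Z_del n S = num_perfect_matchings (induced_subgraph (GG n) (VV n - S))"

definition bvert :: "nat \<Rightarrow> int \<times> int" where
  "bvert n = (2 * int n, 2 * int n + 1 - int n mod 2)"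

text \<open>\<open>gb n j\<close> and \<open>g n i j\<close> are meaningful for indices in the range \<open>0, \<dots>, 2n - 1\<close> only.\<close>

definition gb :: "nat \<Rightarrow> int \<Rightarrow> real" where
  "gb n j = real (Z_del n {(j, j), bvert n}) / real (Z n)"

definition g :: "nat \<Rightarrow> int \<Rightarrow> int \<Rightarrow> real" where
  "g n i j =
     (if i < j then real (Z_del n {(i, i), (j, j)}) / real (Z n)
      else if j < i then - (real (Z_del n {(j, j), (i, i)}) / real (Z n))
      else 0)"

end

theory Submission
  imports Defs
begin

text \<open>
  Write \<open>Z\<^sub>n\<^sup>S\<close> for the number of perfect matchings of \<open>G\<^sub>n\<close> after deletion of \<open>S\<close>. The proof
  rests on two ways of cutting \<open>G\<^sub>n\<close> into a thin piece, whose matchings are rigid, and a rest that is the same for all the counts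
  to be compared.

  \<^bold>\<open>Cutting off the columns 0 and 1.\<close> The columns \<open>x\<^sub>1 \<ge> 2\<close> are a translate of \<open>G\<^bsub>n-1\<^esub>\<close> up to the
  pendant edge in the upper right corner, and this edge exchanges the presence and the absence of
  \<open>b\<close> (\<open>Z_del_right_part\<close>). In the checkerboard colouring every edge joins opposite colours, except
  for the diagonal edges, and the only two diagonal edges that meet the columns 0 and 1 share the vertex
  (1,1). Counting colours, exactly one vertex \<open>u\<close> of column 2 is matched to the left
  (\<open>one_passes_gate\<close>), and the number \<open>w(u)\<close> of matchings to the left of \<open>u\<close> does not depend on what
  is deleted further right. Hence \<open>Z\<^sub>n\<^sup>S\<close> is the sum of \<open>w(u) Z\<^bsub>n-1\<^esub>\<^sup>T\<close> over \<open>u\<close> with \<open>T = S + u + b\<close>, and if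
  \<open>b\<close> is deleted as well the same holds with \<open>T = S + u\<close> (\<open>Z_del_recursion\<close>).

  For \<open>i, j \<ge> 2\<close> the claim, multiplied by \<open>Z\<^sub>n Z\<^bsub>n-1\<^esub>\<close>, is therefore the sum over \<open>u\<close>, with
  weights \<open>w(u)\<close>, of a quadratic identity in \<open>G\<^bsub>n-1\<^esub>\<close> for the four vertices \<open>u\<close>, \<open>(i-2,i-2)\<close>, \<open>(j-2,j-2)\<close>,
  \<open>b\<close>. This is Kuo condensation in its form for planar graphs that need not be bipartite
  (\<open>condensation\<close>): two matchings are superposed, the four vertices are joined in pairs by alternating
  paths, and the colours are swapped along one of them. Planarity enters only through the fact that
  disjoint paths cannot join the four boundary vertices crosswise; for \<open>G\<^sub>n\<close> this follows from a
  parity count (\<open>noncrossing\<close>).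

  For \<open>i = 1\<close> the deletion of (1,1) destroys both of these diagonal edges. The columns 0 and 1 then have exactly one
  matching and detach from the rest (\<open>Z_del_frozen_columns\<close>).

  \<^bold>\<open>Cutting off the diagonal.\<close> For \<open>i = 0\<close> the claim says
  \<open>Z\<^sub>n = Z\<^sub>n\<^sup>S + Z\<^sub>n\<^sup>T\<close> with \<open>S = {(0,0),(j,j)}\<close> and \<open>T = {(j,j),b}\<close>.
  Fix the set of vertices \<open>(k,k+1)\<close> that are matched with diagonal vertices. Together with the
  diagonal they form a strip that has exactly one matching if its size is even and none otherwise
  (\<open>strip_count\<close>). Deleting \<open>(j,j)\<close> divides the strip in two. When its total size is right, the two
  ways of deleting an end vertex, (0,0) or \<open>b\<close>, give opposite parities on the left of
  \<open>(j,j)\<close>, so that exactly one of them is matchable (\<open>diagonal_sum\<close>).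

  Division by \<open>Z\<^sub>n\<close> is harmless because an explicit perfect matching exists (\<open>Z_pos\<close>).
\<close>

section \<open>Cutting graphs and counting their matchings\<close>

text \<open>
  The perfect matchings of the subgraph induced on \<open>W\<close>. Requiring \<open>\<Union>M \<subseteq> W\<close>
  keeps one edge set \<open>E\<close> for all the vertex sets that occur.
\<close>
definition matchings :: "'a set set \<Rightarrow> 'a set \<Rightarrow> 'a set set set" where
  "matchings E W = {M. M \<subseteq> E \<and> \<Union>M \<subseteq> W \<and> (\<forall>v\<in>W. \<exists>!e. e \<in> M \<and> v \<in> e)}"

lemma matchings_unique:
  "M \<in> matchings E W \<Longrightarrow> e \<in> M \<Longrightarrow> f \<in> M \<Longrightarrow> v \<in> e \<Longrightarrow> v \<in> f \<Longrightarrow> e = f"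
  unfolding matchings_def by blast

lemma matchings_cover:
  assumes "M \<in> matchings E W" "v \<in> W"
  obtains e where "e \<in> M" "v \<in> e" "e \<in> E" "e \<subseteq> W"
  using assms unfolding matchings_def by blast

lemma matchings_edge: "M \<in> matchings E W \<Longrightarrow> e \<in> M \<Longrightarrow> e \<in> E \<and> e \<subseteq> W"
  unfolding matchings_def by blast

lemma finite_matchings: "finite E \<Longrightarrow> finite (matchings E W)"
  by (rule finite_subset[of _ "Pow E"]) (auto simp: matchings_def)

lemma num_perfect_matchings_induced:
  assumes "\<And>e. e \<in> E \<Longrightarrow> e \<subseteq> V"
  shows "num_perfect_matchings (induced_subgraph (V, E) (V - S)) = card (matchings E (V - S))"
proof -
  have "{M. perfect_matching (induced_subgraph (V, E) (V - S)) M} = matchings E (V - S)"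
  proof (rule Collect_cong[THEN trans])
    show "perfect_matching (induced_subgraph (V, E) (V - S)) M \<longleftrightarrow>
      M \<subseteq> E \<and> \<Union>M \<subseteq> V - S \<and> (\<forall>v\<in>V - S. \<exists>!e. e \<in> M \<and> v \<in> e)" for M
    proof -
      have "V \<inter> (V - S) = V - S" by blast
      moreover have "M \<subseteq> {e \<in> E. e \<subseteq> V - S} \<longleftrightarrow> M \<subseteq> E \<and> \<Union>M \<subseteq> V - S" by blast
      ultimately show ?thesis unfolding perfect_matching_def induced_subgraph_def by simp
    qed
  qed (simp add: matchings_def)
  then show ?thesis unfolding num_perfect_matchings_def by simp
qed

lemma matchings_image:
  fixes s :: "'a \<Rightarrow> 'b"
  assumes "inj s" and E: "{e \<in> E'. e \<subseteq> s ` W} = (`) s ` {e \<in> E. e \<subseteq> W}"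
  shows "card (matchings E' (s ` W)) = card (matchings E W)"
proof -
  have inj: "inj ((`) s)" "inj ((`) ((`) s))"
    using \<open>inj s\<close> by (simp_all add: inj_image_eq_iff inj_def)
  have "matchings E' (s ` W) = (`) ((`) s) ` matchings E W"
  proof (intro set_eqI iffI)
    fix M assume "M \<in> (`) ((`) s) ` matchings E W"
    then obtain P where P: "P \<in> matchings E W" "M = (`) s ` P" by auto
    have 1: "M \<subseteq> {e \<in> E'. e \<subseteq> s ` W}" unfolding E P(2) using P(1) unfolding matchings_def by auto
    have "\<exists>!e. e \<in> M \<and> v \<in> e" if v: "v \<in> s ` W" for v
    proof -
      obtain w where w: "v = s w" "w \<in> W" using v by auto
      obtain e where e: "e \<in> P" "w \<in> e" using matchings_cover[OF P(1) w(2)] by blast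
      show ?thesis
      proof (rule ex1I[of _ "s ` e"])
        show "s ` e \<in> M \<and> v \<in> s ` e" using P(2) e w by auto
        fix f assume "f \<in> M \<and> v \<in> f"
        then obtain f0 where "f0 \<in> P" "f = s ` f0" "s w \<in> s ` f0" using P(2) w by auto
        moreover have "w \<in> f0" using calculation(3) \<open>inj s\<close> by (simp add: inj_image_mem_iff)
        ultimately show "f = s ` e" using matchings_unique[OF P(1)] e by metis
      qed
    qed
    then show "M \<in> matchings E' (s ` W)" using 1 unfolding matchings_def by auto
  next
    fix M assume M: "M \<in> matchings E' (s ` W)"
    then have "M \<subseteq> {e \<in> E'. e \<subseteq> s ` W}" unfolding matchings_def by auto
    then have "M \<subseteq> (`) s ` {e \<in> E. e \<subseteq> W}" unfolding E .
    then obtain P where P: "P \<subseteq> {e \<in> E. e \<subseteq> W}" "M = (`) s ` P" by (meson subset_image_iff)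
    have "\<exists>!e. e \<in> P \<and> w \<in> e" if w: "w \<in> W" for w
    proof -
      obtain e where e: "e \<in> M" "s w \<in> e" using matchings_cover[OF M, of "s w"] w by blast
      then obtain e0 where e0: "e0 \<in> P" "e = s ` e0" using P(2) by auto
      have we0: "w \<in> e0" using e(2) e0(2) inj_image_mem_iff[OF \<open>inj s\<close>] by simp
      show ?thesis
      proof (rule ex1I[of _ e0])
        show "e0 \<in> P \<and> w \<in> e0" using e0 we0 by auto
        fix f assume f: "f \<in> P \<and> w \<in> f"
        then have "s ` f = s ` e0" using matchings_unique[OF M, of "s ` f" e "s w"] e e0 P(2) by auto
        then show "f = e0" using inj(1) by (simp add: inj_def)
      qed
    qed
    then have "P \<in> matchings E W" using P(1) unfolding matchings_def by auto
    then show "M \<in> (`) ((`) s) ` matchings E W" using P(2) by auto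
  qed
  moreover have "inj_on ((`) ((`) s)) (matchings E W)" using inj(2) by (rule inj_on_subset) simp
  ultimately show ?thesis using card_image by simp
qed

lemma matchings_separated_bij:
  assumes "A \<inter> B = {}" "{} \<notin> E"
  shows "bij_betw (\<lambda>(P, Q). P \<union> Q) (matchings E A \<times> matchings E B)
           {M \<in> matchings E (A \<union> B). \<forall>e\<in>M. e \<subseteq> A \<or> e \<subseteq> B}"
proof (rule bij_betw_byWitness[where f' = "\<lambda>M. ({e \<in> M. e \<subseteq> A}, {e \<in> M. e \<subseteq> B})"])
  have ne: "\<not> (e \<subseteq> A \<and> e \<subseteq> B)" if "e \<in> E" for e
  proof
    assume "e \<subseteq> A \<and> e \<subseteq> B"
    then have "e = {}" using assms(1) by blast
    then show False using that assms(2) by simp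
  qed
  show "\<forall>a\<in>matchings E A \<times> matchings E B. ({e \<in> case a of (P, Q) \<Rightarrow> P \<union> Q. e \<subseteq> A}, {e \<in> case a of (P, Q) \<Rightarrow> P \<union> Q. e \<subseteq> B}) = a"
  proof
    fix x assume "x \<in> matchings E A \<times> matchings E B"
    then obtain P Q where x: "x = (P, Q)" and P: "P \<in> matchings E A" and Q: "Q \<in> matchings E B" by blast
    have "e \<subseteq> A \<and> e \<in> E" if "e \<in> P" for e using matchings_edge[OF P that] by simp
    moreover have "e \<subseteq> B \<and> e \<in> E" if "e \<in> Q" for e using matchings_edge[OF Q that] by simp
    ultimately have "{e \<in> P \<union> Q. e \<subseteq> A} = P" "{e \<in> P \<union> Q. e \<subseteq> B} = Q" using ne by blast+
    then show "({e \<in> case x of (P, Q) \<Rightarrow> P \<union> Q. e \<subseteq> A}, {e \<in> case x of (P, Q) \<Rightarrow> P \<union> Q. e \<subseteq> B}) = x"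
      unfolding x by simp
  qed
  show "\<forall>a'\<in>{M \<in> matchings E (A \<union> B). \<forall>e\<in>M. e \<subseteq> A \<or> e \<subseteq> B}.
       (case ({e \<in> a'. e \<subseteq> A}, {e \<in> a'. e \<subseteq> B}) of (P, Q) \<Rightarrow> P \<union> Q) = a'"
    by auto
  show "(\<lambda>(P, Q). P \<union> Q) ` (matchings E A \<times> matchings E B) \<subseteq> {M \<in> matchings E (A \<union> B). \<forall>e\<in>M. e \<subseteq> A \<or> e \<subseteq> B}"
  proof clarsimp
    fix P Q assume P: "P \<in> matchings E A" and Q: "Q \<in> matchings E B"
    have "\<exists>!e. e \<in> P \<union> Q \<and> v \<in> e" if "v \<in> A \<union> B" for v
    proof (cases "v \<in> A")
      case True
      then have "e \<in> P \<union> Q \<and> v \<in> e \<longleftrightarrow> e \<in> P \<and> v \<in> e" for e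
        using matchings_edge[OF Q] assms by blast
      then show ?thesis using P True unfolding matchings_def by simp
    next
      case False
      then have "e \<in> P \<union> Q \<and> v \<in> e \<longleftrightarrow> e \<in> Q \<and> v \<in> e" for e
        using matchings_edge[OF P] assms by blast
      then show ?thesis using Q False that unfolding matchings_def by simp
    qed
    then show "P \<union> Q \<in> matchings E (A \<union> B) \<and> (\<forall>e\<in>P \<union> Q. e \<subseteq> A \<or> e \<subseteq> B)"
      using P Q unfolding matchings_def by auto
  qed
  show "(\<lambda>M. ({e \<in> M. e \<subseteq> A}, {e \<in> M. e \<subseteq> B})) ` {M \<in> matchings E (A \<union> B). \<forall>e\<in>M. e \<subseteq> A \<or> e \<subseteq> B}
        \<subseteq> matchings E A \<times> matchings E B"
  proof clarsimp
    fix M assume M: "M \<in> matchings E (A \<union> B)" and s: "\<forall>e\<in>M. e \<subseteq> A \<or> e \<subseteq> B"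
    have "\<exists>!e. (e \<in> M \<and> e \<subseteq> A) \<and> v \<in> e" if "v \<in> A" for v
    proof -
      have "(e \<in> M \<and> e \<subseteq> A) \<and> v \<in> e \<longleftrightarrow> e \<in> M \<and> v \<in> e" for e using s that assms by blast
      then show ?thesis using M that unfolding matchings_def by simp
    qed
    moreover have "\<exists>!e. (e \<in> M \<and> e \<subseteq> B) \<and> v \<in> e" if "v \<in> B" for v
    proof -
      have "(e \<in> M \<and> e \<subseteq> B) \<and> v \<in> e \<longleftrightarrow> e \<in> M \<and> v \<in> e" for e using s that assms by blast
      then show ?thesis using M that unfolding matchings_def by simp
    qed
    ultimately show "{e \<in> M. e \<subseteq> A} \<in> matchings E A \<and> {e \<in> M. e \<subseteq> B} \<in> matchings E B"
      using M unfolding matchings_def by auto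
  qed
qed

lemma card_matchings_separated:
  assumes "A \<inter> B = {}" "{} \<notin> E" "\<And>M e. M \<in> matchings E (A \<union> B) \<Longrightarrow> e \<in> M \<Longrightarrow> e \<subseteq> A \<or> e \<subseteq> B"
  shows "card (matchings E (A \<union> B)) = card (matchings E A) * card (matchings E B)"
proof -
  have "{M \<in> matchings E (A \<union> B). \<forall>e\<in>M. e \<subseteq> A \<or> e \<subseteq> B} = matchings E (A \<union> B)" using assms(3) by blast
  then show ?thesis using bij_betw_same_card[OF matchings_separated_bij[OF assms(1,2)]]
    by (simp add: card_cartesian_product)
qed

text \<open>
  This removes pendant edges and, iterated, evaluates path-like graphs.
\<close>
lemma card_matchings_forced:
  assumes E: "\<And>e. e \<in> E \<Longrightarrow> card e = 2" and uw: "{u, w} \<in> E" "u \<in> W" "w \<in> W"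
    and forced: "\<And>M. M \<in> matchings E W \<Longrightarrow> {u, w} \<in> M"
  shows "card (matchings E W) = card (matchings E (W - {u, w}))"
proof -
  have W: "W = {u, w} \<union> (W - {u, w})" using uw by auto
  have ne: "{} \<notin> E" using E[of "{}"] by auto
  have "u \<noteq> w" using E[OF uw(1)] by auto
  have sub: "e = {u, w}" if "e \<subseteq> {u, w}" "e \<in> E" for e
    using card_subset_eq[of "{u, w}" e] that E[of e] \<open>u \<noteq> w\<close> by simp
  have 1: "matchings E {u, w} = {{{u, w}}}"
  proof (intro set_eqI iffI)
    fix M assume M: "M \<in> matchings E {u, w}"
    then have "M \<subseteq> {{u, w}}" using sub matchings_edge[OF M] by blast
    moreover have "M \<noteq> {}" using matchings_cover[OF M, of u] by auto
    ultimately show "M \<in> {{{u, w}}}" by auto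
  next
    fix M assume "M \<in> {{{u, w}}}" then show "M \<in> matchings E {u, w}" using uw unfolding matchings_def by auto
  qed
  have "card (matchings E ({u, w} \<union> (W - {u, w}))) = card (matchings E {u, w}) * card (matchings E (W - {u, w}))"
  proof (rule card_matchings_separated)
    fix M e assume M: "M \<in> matchings E ({u, w} \<union> (W - {u, w}))" and e: "e \<in> M"
    have M': "M \<in> matchings E W" using M W by simp
    show "e \<subseteq> {u, w} \<or> e \<subseteq> W - {u, w}"
      using matchings_unique[OF M' e forced[OF M']] matchings_edge[OF M' e] by blast
  qed (use ne in auto)
  then show ?thesis using W 1 by simp
qed

text \<open>
  Group the matchings by the set \<open>Y\<close> of vertices of \<open>R\<close> that are matched into \<open>Q\<close>.
  As no edge lies inside the interface \<open>F\<close>, a matching of \<open>Q \<union> Y\<close> matches all of \<open>Y\<close> into \<open>Q\<close>, so that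
  \<open>Y\<close> is determined by the matching.
\<close>
lemma card_matchings_cut:
  assumes QR: "Q \<inter> R = {}" and fin: "finite E" and ne: "{} \<notin> E" and F: "F \<subseteq> R" "finite F"
    and cross: "\<And>e. e \<in> E \<Longrightarrow> e \<inter> Q \<noteq> {} \<Longrightarrow> e \<subseteq> Q \<union> R \<Longrightarrow> e \<subseteq> Q \<union> F"
    and indep: "\<And>e. e \<in> E \<Longrightarrow> \<not> e \<subseteq> F"
  shows "card (matchings E (Q \<union> R)) = (\<Sum>Y\<in>Pow F. card (matchings E (Q \<union> Y)) * card (matchings E (R - Y)))"
proof -
  define T where "T Y = {M \<in> matchings E ((Q \<union> Y) \<union> (R - Y)). \<forall>e\<in>M. e \<subseteq> Q \<union> Y \<or> e \<subseteq> R - Y}" for Y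
  have eq: "(Q \<union> Y) \<union> (R - Y) = Q \<union> R" if "Y \<subseteq> F" for Y using that F by auto
  have cardT: "card (T Y) = card (matchings E (Q \<union> Y)) * card (matchings E (R - Y))" if "Y \<in> Pow F" for Y
  proof -
    have "(Q \<union> Y) \<inter> (R - Y) = {}" using QR by blast
    then show ?thesis
      using bij_betw_same_card[OF matchings_separated_bij[of "Q \<union> Y" "R - Y" E]] ne
      unfolding T_def by (simp add: card_cartesian_product)
  qed
  have union: "matchings E (Q \<union> R) = (\<Union>Y\<in>Pow F. T Y)"
  proof (intro set_eqI iffI)
    fix M assume M: "M \<in> matchings E (Q \<union> R)"
    \<comment> \<open>the partners outside \<open>Q\<close> of vertices in \<open>Q\<close>\<close>
    define Y where "Y = \<Union>{e \<in> M. e \<inter> Q \<noteq> {}} - Q"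
    have Y: "Y \<subseteq> F" using cross matchings_edge[OF M] unfolding Y_def by fastforce
    have "e \<subseteq> Q \<union> Y \<or> e \<subseteq> R - Y" if e: "e \<in> M" for e
    proof (cases "e \<inter> Q = {}")
      case True
      have "e \<inter> Y = {}"
      proof (rule ccontr)
        assume "e \<inter> Y \<noteq> {}"
        then obtain y f where "y \<in> e" "y \<in> f" "f \<in> M" "f \<inter> Q \<noteq> {}" unfolding Y_def by blast
        then show False using True matchings_unique[OF M e] by metis
      qed
      then show ?thesis using matchings_edge[OF M e] True by blast
    next
      case False
      then show ?thesis using e unfolding Y_def by blast
    qed
    then have "M \<in> T Y" unfolding T_def using M eq[OF Y] by auto
    then show "M \<in> (\<Union>Y\<in>Pow F. T Y)" using Y by auto
  next
    fix M assume "M \<in> (\<Union>Y\<in>Pow F. T Y)"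
    then show "M \<in> matchings E (Q \<union> R)" unfolding T_def using eq by auto
  qed
  have sub: "Y \<subseteq> Y'" if YY: "Y \<in> Pow F" "Y' \<in> Pow F" and M: "M \<in> T Y" "M \<in> T Y'" for Y Y' M
  proof
    fix y assume y: "y \<in> Y"
    have M': "M \<in> matchings E (Q \<union> R)" using M YY eq unfolding T_def by auto
    have "y \<in> Q \<union> R" using y YY F by auto
    then obtain e where e: "e \<in> M" "y \<in> e" "e \<in> E" "e \<subseteq> Q \<union> R" by (rule matchings_cover[OF M'])
    have 1: "e \<subseteq> Q \<union> Y" using M(1) e(1,2) y unfolding T_def by blast
    show "y \<in> Y'"
    proof (rule ccontr)
      assume "y \<notin> Y'"
      moreover have "y \<notin> Q" using y YY F QR by auto
      ultimately have "e \<subseteq> R - Y'" using M(2) e(1,2) unfolding T_def by blast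
      then have "e \<subseteq> F" using 1 QR YY by blast
      then show False using indep e(3) by blast
    qed
  qed
  have "card (matchings E (Q \<union> R)) = (\<Sum>Y\<in>Pow F. card (T Y))"
    unfolding union
  proof (rule card_UN_disjoint)
    show "\<forall>Y\<in>Pow F. finite (T Y)" unfolding T_def using finite_matchings[OF fin] by auto
    show "\<forall>i\<in>Pow F. \<forall>j\<in>Pow F. i \<noteq> j \<longrightarrow> T i \<inter> T j = {}"
    proof (intro ballI impI)
      fix Y Y' assume "Y \<in> Pow F" "Y' \<in> Pow F" "Y \<noteq> Y'"
      then show "T Y \<inter> T Y' = {}" using sub[of Y Y'] sub[of Y' Y] by blast
    qed
  qed (use F in auto)
  then show ?thesis using cardT by simp
qed

section \<open>Condensation\<close>

definition deg :: "'a set set \<Rightarrow> 'a \<Rightarrow> nat" where "deg P v = card {e \<in> P. v \<in> e}"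

text \<open>
  The boundary of \<open>P\<close> as a chain modulo 2. A path with further closed curves has its two
  end vertices here, so \<open>odd_verts P = {a, z}\<close> replaces the statement that \<open>P\<close> joins \<open>a\<close> and \<open>z\<close>.
\<close>
definition odd_verts :: "'a set set \<Rightarrow> 'a set" where "odd_verts P = {v. odd (deg P v)}"

lemma deg_pos: "finite P \<Longrightarrow> deg P v > 0 \<longleftrightarrow> v \<in> \<Union>P"
  unfolding deg_def by (auto simp: card_gt_0_iff)

lemma deg_insert: "finite P \<Longrightarrow> e \<notin> P \<Longrightarrow> deg (insert e P) v = (if v \<in> e then Suc (deg P v) else deg P v)"
proof -
  assume "finite P" "e \<notin> P"
  moreover have "{f \<in> insert e P. v \<in> f} = (if v \<in> e then insert e {f \<in> P. v \<in> f} else {f \<in> P. v \<in> f})" by auto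
  ultimately show ?thesis unfolding deg_def by auto
qed

lemma deg_1_unique: "deg P v = 1 \<Longrightarrow> e \<in> P \<Longrightarrow> v \<in> e \<Longrightarrow> f \<in> P \<Longrightarrow> v \<in> f \<Longrightarrow> e = f"
proof -
  assume "deg P v = 1" and ef: "e \<in> P" "v \<in> e" "f \<in> P" "v \<in> f"
  then have "card {e \<in> P. v \<in> e} = 1" by (simp add: deg_def)
  then obtain x where "{e \<in> P. v \<in> e} = {x}" by (rule card_1_singletonE)
  moreover have "e \<in> {e \<in> P. v \<in> e}" "f \<in> {e \<in> P. v \<in> e}" using ef by simp_all
  ultimately show "e = f" by simp
qed

lemma even_card_odd_verts:
  assumes "finite P" "\<And>e. e \<in> P \<Longrightarrow> card e = 2"
  shows "even (card (odd_verts P))"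
proof -
  have fU: "finite (\<Union>P)"
  proof (rule finite_Union)
    show "finite e" if "e \<in> P" for e using assms(2)[OF that] by (simp add: card_ge_0_finite)
  qed (fact assms(1))
  have "(\<Sum>v\<in>\<Union>P. deg P v) = (\<Sum>v\<in>\<Union>P. \<Sum>e\<in>P. if v \<in> e then 1 else 0)"
    unfolding deg_def using assms(1) by (simp add: sum.If_cases Collect_conj_eq)
  also have "\<dots> = (\<Sum>e\<in>P. \<Sum>v\<in>\<Union>P. if v \<in> e then 1 else 0)" by (rule sum.swap)
  also have "\<dots> = (\<Sum>e\<in>P. card e)"
  proof (rule sum.cong)
    fix e assume "e \<in> P"
    then have "\<Union>P \<inter> {v. v \<in> e} = e" by auto
    then show "(\<Sum>v\<in>\<Union>P. if v \<in> e then 1 else 0) = card e" using fU by (simp add: sum.If_cases)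
  qed simp
  also have "\<dots> = 2 * card P" using assms(2) by simp
  finally have "even (\<Sum>v\<in>\<Union>P. deg P v)" by simp
  moreover have "odd_verts P = {v \<in> \<Union>P. odd (deg P v)}"
    unfolding odd_verts_def using deg_pos[OF assms(1)] by (auto dest: odd_pos)
  ultimately show ?thesis using fU by (simp add: even_sum_iff)
qed

text \<open>
  If all degrees are at most 2, the edges can be followed from a vertex of degree 1 until
  another such vertex is reached. The induction deletes the first edge of the path and continues from its
  other end. The last conjunct says that \<open>C\<close> is a union of connected components of \<open>D\<close>.
\<close>
lemma path_split:
  assumes "finite D" "\<And>e. e \<in> D \<Longrightarrow> card e = 2" "\<And>v. deg D v \<le> 2" "deg D a = 1"
  shows "\<exists>C z. C \<subseteq> D \<and> z \<noteq> a \<and> odd_verts C = {a, z} \<and> deg D z = 1 \<and> (\<forall>e\<in>C. \<forall>f\<in>D - C. e \<inter> f = {})"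
  using assms
proof (induction "card D" arbitrary: D a)
  case 0
  then show ?case by (simp add: deg_def)
next
  case (Suc k)
  obtain e where e: "e \<in> D" "a \<in> e"
    using deg_pos[OF Suc.prems(1), of a] Suc.prems(4) by auto
  obtain u where u: "e = {a, u}" "u \<noteq> a"
  proof -
    obtain x y where "e = {x, y}" "x \<noteq> y" using Suc.prems(2)[OF e(1)] by (auto simp: card_2_iff)
    then show ?thesis using e(2) that[of x] that[of y] by (auto simp: insert_commute)
  qed
  define D' where "D' = D - {e}"
  have D: "D = insert e D'" "e \<notin> D'" "finite D'" using e Suc.prems(1) unfolding D'_def by auto
  have dD: "deg D v = (if v \<in> e then Suc (deg D' v) else deg D' v)" for v
    using deg_insert[OF D(3,2)] D(1) by simp
  show ?case
  proof (cases "deg D u = 1")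
    case True
    have "odd_verts {e} = {a, u}" using u deg_insert[of "{}" e] by (auto simp: odd_verts_def deg_def split: if_splits)
    moreover have "\<forall>f\<in>D - {e}. e \<inter> f = {}"
      using deg_1_unique[OF True e(1)] deg_1_unique[OF Suc.prems(4) e(1)] u by auto
    ultimately show ?thesis using True u e by (intro exI[of _ "{e}"] exI[of _ u]) auto
  next
    case False
    then have du: "deg D' u = 1" using dD[of u] Suc.prems(3)[of u] u by auto
    have da: "deg D' a = 0" using dD[of a] Suc.prems(4) u by auto
    have "\<exists>C z. C \<subseteq> D' \<and> z \<noteq> u \<and> odd_verts C = {u, z} \<and> deg D' z = 1 \<and> (\<forall>e\<in>C. \<forall>f\<in>D' - C. e \<inter> f = {})"
    proof (rule Suc.hyps(1))
      show "k = card D'" using Suc.hyps(2) D by simp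
      show "deg D' v \<le> 2" for v using dD[of v] Suc.prems(3)[of v] by (auto split: if_splits)
      show "finite D'" "deg D' u = 1" by fact+
      show "card e = 2" if "e \<in> D'" for e using Suc.prems(2) that D(1) by simp
    qed
    then obtain C z where C: "C \<subseteq> D'" "z \<noteq> u" "odd_verts C = {u, z}" "deg D' z = 1"
      "\<forall>e\<in>C. \<forall>f\<in>D' - C. e \<inter> f = {}" by (elim exE conjE) (rule that; assumption)
    have za: "z \<noteq> a" using C(4) da by auto
    have finC: "finite C" "e \<notin> C" using C(1) D finite_subset by auto
    have dC: "deg (insert e C) v = (if v \<in> e then Suc (deg C v) else deg C v)" for v
      using deg_insert[OF finC] .
    have od: "odd (deg C v) \<longleftrightarrow> v = u \<or> v = z" for v using C(3) unfolding odd_verts_def by blast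
    have "odd_verts (insert e C) = {a, z}"
      unfolding odd_verts_def using dC od u za C(2) by auto
    moreover have "deg D z = 1" using dD[of z] C(2,4) za u by auto
    moreover have "g \<inter> f = {}" if g: "g \<in> insert e C" and f: "f \<in> D - insert e C" for g f
    proof (cases "g = e")
      case True
      have "a \<notin> f" using deg_1_unique[OF Suc.prems(4) e(1,2), of f] f by auto
      moreover have "u \<notin> f"
      proof
        assume "u \<in> f"
        have "deg C u > 0" using od[of u] by (auto dest: odd_pos)
        then obtain c where "c \<in> C" "u \<in> c" using deg_pos[OF finC(1)] by auto
        then show False using deg_1_unique[OF du, of f c] f D C(1) \<open>u \<in> f\<close> by auto
      qed
      ultimately show ?thesis using True u by auto
    next
      case False
      then show ?thesis using g f D C(5) by auto
    qed
    moreover have "insert e C \<subseteq> D" using C(1) D by blast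
    ultimately show ?thesis using za by blast
  qed
qed

text \<open>
  Exchanging the two matchings on a union \<open>C\<close> of components of their superposition: at a vertex of \<open>C\<close>
  the new matching looks like \<open>M2\<close>, elsewhere like \<open>M1\<close>. So the deleted set is \<open>B\<close> on \<open>C\<close> and \<open>A\<close> off \<open>C\<close>.
\<close>
lemma matchings_switch:
  assumes M1: "M1 \<in> matchings E (V - A)" and M2: "M2 \<in> matchings E (V - B)"
    and C: "C \<subseteq> sym_diff M1 M2" and cl: "\<forall>e\<in>C. \<forall>f\<in>sym_diff M1 M2 - C. e \<inter> f = {}"
  shows "sym_diff M1 C \<in> matchings E (V - ((A - \<Union>C) \<union> (B \<inter> \<Union>C)))"
proof -
  let ?M = "sym_diff M1 C"
  have inC: "e \<in> C" if e: "e \<in> M1 \<union> M2" "v \<in> e" and v: "v \<in> \<Union>C" for e v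
  proof -
    obtain c where c: "c \<in> C" "v \<in> c" using v by auto
    then have "c \<in> M1 \<and> c \<notin> M2 \<or> c \<in> M2 \<and> c \<notin> M1" using C by auto
    then have "e = c \<or> e \<in> sym_diff M1 M2"
      using matchings_unique[OF M1, of e c v] matchings_unique[OF M2, of e c v] e c by blast
    then show ?thesis using c e cl by blast
  qed
  have at1: "e \<in> ?M \<and> v \<in> e \<longleftrightarrow> e \<in> M2 \<and> v \<in> e" if "v \<in> \<Union>C" for e v
    using inC[of e v] that C by blast
  have at2: "e \<in> ?M \<and> v \<in> e \<longleftrightarrow> e \<in> M1 \<and> v \<in> e" if "v \<notin> \<Union>C" for e v
    using that by blast
  have M1d: "M1 \<subseteq> E" "\<Union>M1 \<subseteq> V - A" "\<And>v. v \<in> V - A \<Longrightarrow> \<exists>!e. e \<in> M1 \<and> v \<in> e"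
    and M2d: "M2 \<subseteq> E" "\<Union>M2 \<subseteq> V - B" "\<And>v. v \<in> V - B \<Longrightarrow> \<exists>!e. e \<in> M2 \<and> v \<in> e"
    using M1 M2 unfolding matchings_def by auto
  have N1: "?M \<subseteq> E" using M1d(1) M2d(1) C by blast
  have N2: "v \<in> V - ((A - \<Union>C) \<union> (B \<inter> \<Union>C))" if v: "v \<in> \<Union>?M" for v
  proof -
    obtain e where e: "e \<in> ?M" "v \<in> e" using v by (rule UnionE)
    show ?thesis
    proof (cases "v \<in> \<Union>C")
      case True then show ?thesis using at1[OF True, of e] e M2d(2) by blast
    next
      case False then show ?thesis using at2[OF False, of e] e M1d(2) by blast
    qed
  qed
  have N3: "\<exists>!e. e \<in> ?M \<and> v \<in> e" if v: "v \<in> V - ((A - \<Union>C) \<union> (B \<inter> \<Union>C))" for v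
  proof (cases "v \<in> \<Union>C")
    case True
    then have "v \<in> V - B" using v by simp
    then show ?thesis unfolding at1[OF True] by (rule M2d(3))
  next
    case False
    then have "v \<in> V - A" using v by simp
    then show ?thesis unfolding at2[OF False] by (rule M1d(3))
  qed
  show ?thesis
    unfolding matchings_def by (rule CollectI conjI N1 subsetI[OF N2] ballI N3 | assumption)+
qed

lemma deg_matchings: "M \<in> matchings E W \<Longrightarrow> deg M v = (if v \<in> W then 1 else 0)"
proof -
  assume M: "M \<in> matchings E W"
  show ?thesis
  proof (cases "v \<in> W")
    case True
    then obtain e where "e \<in> M" "v \<in> e" using matchings_cover[OF M] by blast
    then have "{f \<in> M. v \<in> f} = {e}" using matchings_unique[OF M] by blast
    then show ?thesis unfolding deg_def using True by simp
  next
    case False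
    then have "{f \<in> M. v \<in> f} = {}" using matchings_edge[OF M] by blast
    then show ?thesis unfolding deg_def using False by (simp only: card.empty if_False)
  qed
qed

lemma deg_Un_disjoint:
  assumes "finite P" "finite Q" "P \<inter> Q = {}"
  shows "deg (P \<union> Q) v = deg P v + deg Q v"
proof -
  have "{e \<in> P \<union> Q. v \<in> e} = {e \<in> P. v \<in> e} \<union> {e \<in> Q. v \<in> e}" by blast
  then show ?thesis unfolding deg_def using assms by (simp add: card_Un_disjoint disjoint_iff)
qed

lemma deg_Diff:
  assumes "finite P" "Q \<subseteq> P"
  shows "deg P v = deg Q v + deg (P - Q) v"
  using deg_Un_disjoint[of Q "P - Q" v] assms by (simp add: finite_subset Un_absorb1)

lemma deg_sym_diff:
  assumes "finite P" "finite Q"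
  shows "deg (sym_diff P Q) v + 2 * deg (P \<inter> Q) v = deg P v + deg Q v"
proof -
  have "deg (sym_diff P Q) v = deg (P - Q) v + deg (Q - P) v"
    using assms by (intro deg_Un_disjoint) auto
  moreover have "deg P v = deg (P \<inter> Q) v + deg (P - P \<inter> Q) v" using assms by (intro deg_Diff) auto
  moreover have "deg Q v = deg (P \<inter> Q) v + deg (Q - P \<inter> Q) v" using assms by (intro deg_Diff) auto
  moreover have "P - P \<inter> Q = P - Q" "Q - P \<inter> Q = Q - P" by auto
  ultimately show ?thesis by simp
qed

text \<open>
  The path from \<open>a\<close> cannot end at \<open>c\<close>, since the remaining edges would then join \<open>b\<close> and \<open>d\<close>.
\<close>
lemma noncrossing_split:
  assumes "finite E" "\<And>e. e \<in> E \<Longrightarrow> card e = 2" "distinct [a, b, c, d]" "D \<subseteq> E"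
    and deg: "\<And>v. v \<in> {a, b, c, d} \<Longrightarrow> deg D v = 1" "\<And>v. v \<notin> {a, b, c, d} \<Longrightarrow> deg D v = 0 \<or> deg D v = 2"
    and planar: "\<And>P Q. P \<subseteq> E \<Longrightarrow> Q \<subseteq> E \<Longrightarrow> \<Union>P \<inter> \<Union>Q = {} \<Longrightarrow> odd_verts P = {a, c} \<Longrightarrow> odd_verts Q = {b, d} \<Longrightarrow> False"
  shows "\<exists>C. (odd_verts C = {a, b} \<or> odd_verts C = {a, d}) \<and> C \<subseteq> D \<and> (\<forall>e\<in>C. \<forall>f\<in>D - C. e \<inter> f = {})"
proof -
  have finD: "finite D" using assms(1,4) finite_subset by blast
  have le: "deg D v \<le> 2" for v using deg(1)[of v] deg(2)[of v] by (cases "v \<in> {a, b, c, d}") fastforce+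
  have "\<exists>C z. C \<subseteq> D \<and> z \<noteq> a \<and> odd_verts C = {a, z} \<and> deg D z = 1 \<and> (\<forall>e\<in>C. \<forall>f\<in>D - C. e \<inter> f = {})"
    using finD assms(2,4) le deg(1)[of a] by (intro path_split) auto
  then obtain C z where C: "C \<subseteq> D" "z \<noteq> a" "odd_verts C = {a, z}" "deg D z = 1"
      "\<forall>e\<in>C. \<forall>f\<in>D - C. e \<inter> f = {}" by (elim exE conjE) (rule that; assumption)
  have z: "z \<in> {a, b, c, d}" using deg(2)[of z] C(4) by (cases "z \<in> {a, b, c, d}") auto
  have oD: "odd (deg D v) \<longleftrightarrow> v \<in> {a, b, c, d}" for v using deg(1)[of v] deg(2)[of v] by (cases "v \<in> {a, b, c, d}") fastforce+
  have oC: "odd (deg C v) \<longleftrightarrow> v = a \<or> v = z" for v using C(3) unfolding odd_verts_def by blast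
  have "z \<noteq> c"
  proof
    assume zc: "z = c"
    have "odd (deg (D - C) v) \<longleftrightarrow> v = b \<or> v = d" for v
      using deg_Diff[OF finD C(1), of v] oD[of v] oC[of v] zc assms(3) by auto
    then have "odd_verts (D - C) = {b, d}" unfolding odd_verts_def by blast
    moreover have "\<Union>C \<inter> \<Union>(D - C) = {}" using C(5) by blast
    ultimately show False using planar[of C "D - C"] C(1,3) zc assms(4) by blast
  qed
  then have "odd_verts C = {a, b} \<or> odd_verts C = {a, d}" using z C(2,3) by blast
  then show ?thesis using C by blast
qed

text \<open>
  Kuo's condensation identity. The four vertices are meant to lie on the outer face of a plane graph in the
  cyclic order \<open>a\<close>, \<open>b\<close>, \<open>c\<close>, \<open>d\<close>; the hypothesis \<open>planar\<close> extracts from this that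
  disjoint paths cannot join them crosswise. On each side, count pairs \<open>(M, M')\<close> where \<open>M\<close> avoids a set \<open>A \<subseteq> {a, b, c, d}\<close> and \<open>M'\<close>
  avoids the rest of the four vertices. Swapping along the path from \<open>a\<close> to its end \<open>z\<close>
  replaces \<open>A\<close> by its symmetric difference with \<open>{a, z}\<close>, and the superposition of the pair is unchanged, so the swap is
  an involution. Here \<open>z\<close> is \<open>b\<close> or \<open>d\<close>, and matching up the two cases on both sides gives
  the identity.
\<close>
lemma condensation:
  fixes E :: "'a set set"
  assumes fin: "finite E" and two: "\<And>e. e \<in> E \<Longrightarrow> card e = 2" and dist: "distinct [a, b, c, d]"
    and V: "{a, b, c, d} \<subseteq> V"
    and planar: "\<And>P Q. P \<subseteq> E \<Longrightarrow> Q \<subseteq> E \<Longrightarrow> \<Union>P \<inter> \<Union>Q = {} \<Longrightarrow> odd_verts P = {a, c} \<Longrightarrow> odd_verts Q = {b, d} \<Longrightarrow> False"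
  shows "card (matchings E V) * card (matchings E (V - {a, b, c, d})) + card (matchings E (V - {a, c})) * card (matchings E (V - {b, d}))
       = card (matchings E (V - {a, b})) * card (matchings E (V - {c, d})) + card (matchings E (V - {a, d})) * card (matchings E (V - {b, c}))"
proof -
  define X where "X = {a, b, c, d}"
  \<comment> \<open>Any choice works as long as it depends on the superposition only, which the swap preserves.\<close>
  define C where "C D = (SOME C. (odd_verts C = {a, b} \<or> odd_verts C = {a, d}) \<and> C \<subseteq> D \<and> (\<forall>e\<in>C. \<forall>f\<in>D - C. e \<inter> f = {}))" for D
  define T where "T A = matchings E (V - A) \<times> matchings E (V - (X - A))" for A
  define Tz where "Tz A z = {(M, M') \<in> T A. odd_verts (C (sym_diff M M')) = {a, z}}" for A z
  define f where "f = (\<lambda>(M, M'). (sym_diff M (C (sym_diff M M')), sym_diff M' (C (sym_diff M M'))))"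
  have finM: "finite M" if "M \<in> matchings E W" for M W using that fin finite_subset unfolding matchings_def by blast
  have finT: "finite (T A)" for A unfolding T_def using finite_matchings[OF fin] by simp
  have D: "deg (sym_diff M M') v = 1" if "(M, M') \<in> T A" "A \<subseteq> X" "v \<in> X" for M M' A v
  proof -
    have M: "M \<in> matchings E (V - A)" "M' \<in> matchings E (V - (X - A))" using that(1) unfolding T_def by auto
    have "deg M v + deg M' v = 1" using deg_matchings[OF M(1), of v] deg_matchings[OF M(2), of v] that(2,3) V
      unfolding X_def[symmetric] by auto
    then show ?thesis using deg_sym_diff[OF finM[OF M(1)] finM[OF M(2)], of v] by presburger
  qed
  have D': "deg (sym_diff M M') v = 0 \<or> deg (sym_diff M M') v = 2" if "(M, M') \<in> T A" "A \<subseteq> X" "v \<notin> X" for M M' A v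
  proof -
    have M: "M \<in> matchings E (V - A)" "M' \<in> matchings E (V - (X - A))" using that(1) unfolding T_def by auto
    have "deg M v + deg M' v = (if v \<in> V then 2 else 0)"
      using deg_matchings[OF M(1), of v] deg_matchings[OF M(2), of v] that(2,3) by auto
    then show ?thesis using deg_sym_diff[OF finM[OF M(1)] finM[OF M(2)], of v]
      by (auto split: if_splits) presburger
  qed
  have DE: "sym_diff M M' \<subseteq> E" if "(M, M') \<in> T A" for M M' A using that unfolding T_def matchings_def by blast
  have C: "odd_verts (C (sym_diff M M')) = {a, b} \<or> odd_verts (C (sym_diff M M')) = {a, d}"
    "C (sym_diff M M') \<subseteq> sym_diff M M'" "\<forall>e\<in>C (sym_diff M M'). \<forall>f\<in>sym_diff M M' - C (sym_diff M M'). e \<inter> f = {}"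
    if "(M, M') \<in> T A" "A \<subseteq> X" for M M' A
  proof -
    have "\<exists>C. (odd_verts C = {a, b} \<or> odd_verts C = {a, d}) \<and> C \<subseteq> sym_diff M M' \<and> (\<forall>e\<in>C. \<forall>f\<in>sym_diff M M' - C. e \<inter> f = {})"
      using D[OF that] D'[OF that] DE[OF that(1)] unfolding X_def
      by (intro noncrossing_split[OF fin two dist _ _ _ planar]) auto
    from someI_ex[OF this] show "odd_verts (C (sym_diff M M')) = {a, b} \<or> odd_verts (C (sym_diff M M')) = {a, d}"
      "C (sym_diff M M') \<subseteq> sym_diff M M'" "\<forall>e\<in>C (sym_diff M M'). \<forall>f\<in>sym_diff M M' - C (sym_diff M M'). e \<inter> f = {}"
      unfolding C_def[symmetric] by blast+
  qed
  have fT: "f p \<in> Tz (sym_diff A {a, z}) z \<and> f (f p) = p" if pT: "p \<in> Tz A z" and that: "A \<subseteq> X" "z \<in> {b, d}" for p A z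
  proof -
    obtain M M' where p: "p = (M, M')" "(M, M') \<in> T A" and odd: "odd_verts (C (sym_diff M M')) = {a, z}"
      using pT unfolding Tz_def by blast
    let ?D = "sym_diff M M'"
    define K where "K = C ?D"
    have K: "K \<subseteq> ?D" "\<forall>e\<in>K. \<forall>f\<in>?D - K. e \<inter> f = {}" "odd_verts K = {a, z}"
      using C(2,3)[OF p(2) that(1)] odd unfolding K_def by auto
    have finD: "finite ?D" using DE[OF p(2)] fin finite_subset by blast
    have finK: "finite K" using K(1) finD finite_subset by blast
    have KX: "v \<in> \<Union>K \<longleftrightarrow> v = a \<or> v = z" if "v \<in> X" for v
    proof -
      have "deg K v \<le> 1" using deg_Diff[OF finD K(1), of v] D[OF p(2) \<open>A \<subseteq> X\<close> that] by simp
      then have "deg K v > 0 \<longleftrightarrow> odd (deg K v)" by (cases "deg K v") auto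
      moreover have "odd (deg K v) \<longleftrightarrow> v = a \<or> v = z" using K(3) unfolding odd_verts_def by blast
      ultimately show ?thesis using deg_pos[OF finK, of v] by simp
    qed
    have zX: "a \<in> X" "z \<in> X" using that(2) unfolding X_def by auto
    have A1: "(A - \<Union>K) \<union> ((X - A) \<inter> \<Union>K) = sym_diff A {a, z}"
      using KX that(1) zX by blast
    have A2: "((X - A) - \<Union>K) \<union> (A \<inter> \<Union>K) = X - sym_diff A {a, z}"
      using KX that(1) zX by blast
    have "sym_diff M K \<in> matchings E (V - sym_diff A {a, z})"
      using matchings_switch[of M E V A M' "X - A" K] p(2) K unfolding T_def A1 by blast
    moreover have "sym_diff M' K \<in> matchings E (V - (X - sym_diff A {a, z}))"
      using matchings_switch[of M' E V "X - A" M A K] p(2) K unfolding T_def A2 by (simp add: Un_commute)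
    moreover have fp: "f p = (sym_diff M K, sym_diff M' K)" unfolding f_def p(1) K_def by simp
    moreover have DD: "sym_diff (sym_diff M K) (sym_diff M' K) = ?D" by blast
    ultimately have "f p \<in> Tz (sym_diff A {a, z}) z" unfolding Tz_def T_def using odd by simp
    moreover have "f (f p) = p" unfolding fp f_def prod.case DD K_def[symmetric] p(1) by blast
    ultimately show ?thesis by simp
  qed
  have swap: "card (Tz A z) = card (Tz (sym_diff A {a, z}) z)" if "A \<subseteq> X" "z \<in> {b, d}" for A z
  proof (rule bij_betw_same_card, rule bij_betw_byWitness[where f = f and f' = f])
    have A': "sym_diff A {a, z} \<subseteq> X" "sym_diff (sym_diff A {a, z}) {a, z} = A" using that unfolding X_def by auto
    show "\<forall>p\<in>Tz A z. f (f p) = p" "f ` Tz A z \<subseteq> Tz (sym_diff A {a, z}) z" using fT[OF _ that] by auto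
    show "\<forall>p\<in>Tz (sym_diff A {a, z}) z. f (f p) = p" "f ` Tz (sym_diff A {a, z}) z \<subseteq> Tz A z"
      using fT[OF _ A'(1) that(2)] unfolding A'(2) by auto
  qed
  \<comment> \<open>The order of the two matchings is immaterial; this identifies \<open>A\<close> with its complement.\<close>
  have flip: "card (Tz A z) = card (Tz (X - A) z)" if "A \<subseteq> X" for A z
  proof (rule bij_betw_same_card, rule bij_betw_byWitness[where f = prod.swap and f' = prod.swap])
    have "X - (X - A) = A" using that by auto
    then show "prod.swap ` Tz A z \<subseteq> Tz (X - A) z" "prod.swap ` Tz (X - A) z \<subseteq> Tz A z"
      unfolding Tz_def T_def by (auto simp: Un_commute)
  qed auto
  have split: "card (matchings E (V - A)) * card (matchings E (V - (X - A))) = card (Tz A b) + card (Tz A d)" if "A \<subseteq> X" for A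
  proof -
    have "T A = Tz A b \<union> Tz A d" unfolding Tz_def using C(1)[OF _ that] by blast
    moreover have "Tz A b \<inter> Tz A d = {}" unfolding Tz_def using dist by (auto simp: doubleton_eq_iff)
    ultimately have "card (T A) = card (Tz A b) + card (Tz A d)"
      using finT[of A] by (simp add: card_Un_disjoint)
    then show ?thesis unfolding T_def by (simp add: card_cartesian_product)
  qed
  have X: "X - {} = {a, b, c, d}" "X - {a, c} = {b, d}" "X - {a, b} = {c, d}" "X - {a, d} = {b, c}"
    "X - {b, c} = {a, d}" "X - {c, d} = {a, b}"
    using dist unfolding X_def by auto
  have s: "sym_diff {} {a, b} = {a, b}" "sym_diff {} {a, d} = {a, d}" "sym_diff {a, c} {a, b} = {b, c}"
    "sym_diff {a, c} {a, d} = {c, d}" using dist by auto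
  have 1: "card (Tz {} b) = card (Tz {a, b} b)" using swap[of "{}" b] s by simp
  have 2: "card (Tz {} d) = card (Tz {a, d} d)" using swap[of "{}" d] s by simp
  have 3: "card (Tz {a, c} b) = card (Tz {a, d} b)"
    using swap[of "{a, c}" b] flip[of "{b, c}" b] unfolding s X by (simp add: X_def)
  have 4: "card (Tz {a, c} d) = card (Tz {a, b} d)"
    using swap[of "{a, c}" d] flip[of "{c, d}" d] unfolding s X by (simp add: X_def)
  have sub: "{a, c} \<subseteq> X" "{a, b} \<subseteq> X" "{a, d} \<subseteq> X" unfolding X_def by auto
  show ?thesis
    using split[of "{}"] split[OF sub(1)] split[OF sub(2)] split[OF sub(3)] unfolding X 1 2 3 4 by simp
qed

section \<open>The edges of \<open>G\<^sub>n\<close> and its planarity\<close>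

lemma finite_VV: "finite (VV n)"
  by (rule finite_subset[of _ "{0..2 * int n} \<times> {0..2 * int n + 1}"]) (auto simp: VV_def)

lemma EE_cases:
  assumes "e \<in> EE n"
  obtains
    (horizontal) x y where "e = {(x, y), (x + 1, y)}" "0 \<le> x" "x \<le> 2 * int n - 1" "x < y" "y \<le> 2 * int n + 1" "odd (x + y)"
  | (vertical) x y where "e = {(x, y), (x, y + 1)}" "0 \<le> x" "x \<le> 2 * int n - int n mod 2" "x \<le> y" "y \<le> 2 * int n"
  | (diagonal) x where "e = {(x, x), (x + 1, x + 1)}" "0 \<le> x" "x \<le> 2 * int n - 1"
proof -
  from assms consider
    x y where "e = {(x, y), (x + 1, y)}" "0 \<le> x" "x \<le> 2 * int n - 1" "x \<le> y" "y \<le> 2 * int n + 1" "(x + y) mod 2 = 1"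
  | x y where "e = {(x, y), (x, y + 1)}" "0 \<le> x" "x \<le> 2 * int n - int n mod 2" "x \<le> y" "y \<le> 2 * int n"
  | x where "e = {(x, x), (x + 1, x + 1)}" "0 \<le> x" "x \<le> 2 * int n - 1"
    unfolding EE_def by blast
  then show thesis
  proof cases
    case (1 x y)
    have "odd (x + y)" using 1(6) by presburger
    moreover have "x \<noteq> y" using 1(6) by auto
    ultimately show thesis using horizontal[OF 1(1-3)] 1(4,5) by simp
  next
    case 2 then show thesis by (rule vertical)
  next
    case 3 then show thesis by (rule diagonal)
  qed
qed

lemma horizontal_edge: "{(x, y), (x + 1, y)} \<in> EE n"
  if "0 \<le> x" "x \<le> 2 * int n - 1" "x < y" "y \<le> 2 * int n + 1" "odd (x + y)"
proof -
  have "(x + y) mod 2 = 1" using that(5) by presburger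
  then show ?thesis
    using that unfolding EE_def by (intro UnI1 CollectI exI[of _ x] exI[of _ y]) simp
qed

lemma vertical_edge: "{(x, y), (x, y + 1)} \<in> EE n"
  if "0 \<le> x" "x \<le> 2 * int n - int n mod 2" "x \<le> y" "y \<le> 2 * int n"
  using that unfolding EE_def by blast

lemma diagonal_edge: "{(x, x), (x + 1, x + 1)} \<in> EE n"
  if "0 \<le> x" "x \<le> 2 * int n - 1"
  using that unfolding EE_def by blast

lemma card_EE: "e \<in> EE n \<Longrightarrow> card e = 2"
  by (erule EE_cases) auto

lemma mem_VV: "(x, y) \<in> VV n \<longleftrightarrow> 0 \<le> x \<and> x \<le> 2 * int n \<and> x \<le> y \<and> y \<le> 2 * int n + 1
    \<and> \<not> (odd n \<and> x = 2 * int n \<and> y = 2 * int n + 1)"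
  unfolding VV_def by auto

lemma EE_subset_VV: "e \<in> EE n \<Longrightarrow> e \<subseteq> VV n"
proof (erule EE_cases)
  fix x y assume "e = {(x, y), (x + 1, y)}" "0 \<le> x" "x \<le> 2 * int n - 1" "x < y" "y \<le> 2 * int n + 1" "odd (x + y)"
  moreover have "\<not> (x + 1 = 2 * int n \<and> y = 2 * int n + 1)" using \<open>odd (x + y)\<close> by presburger
  ultimately show ?thesis by (auto simp: mem_VV)
next
  fix x y assume "e = {(x, y), (x, y + 1)}" "0 \<le> x" "x \<le> 2 * int n - int n mod 2" "x \<le> y" "y \<le> 2 * int n"
  moreover have "\<not> (odd n \<and> x = 2 * int n)" using \<open>x \<le> 2 * int n - int n mod 2\<close> by presburger
  ultimately show ?thesis by (auto simp: mem_VV)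
next
  fix x assume "e = {(x, x), (x + 1, x + 1)}" "0 \<le> x" "x \<le> 2 * int n - 1"
  then show ?thesis by (auto simp: mem_VV)
qed

lemma finite_EE: "finite (EE n)"
  by (rule finite_subset[of _ "Pow (VV n)"]) (use EE_subset_VV finite_VV in auto)

lemma Z_eq_matchings: "Z n = card (matchings (EE n) (VV n))"
proof -
  have "induced_subgraph (GG n) (VV n - {}) = GG n"
    unfolding induced_subgraph_def GG_def using EE_subset_VV[of _ n] by auto
  then show ?thesis
    using num_perfect_matchings_induced[of "EE n" "VV n" "{}"] EE_subset_VV[of _ n]
    unfolding Z_def GG_def by simp
qed

lemma Z_del_eq_matchings: "Z_del n S = card (matchings (EE n) (VV n - S))"
  unfolding Z_del_def GG_def by (rule num_perfect_matchings_induced) (rule EE_subset_VV)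

text \<open>
  The possible edges at a given vertex. Above the diagonal there are three of them, because the parity of \<open>x + y\<close>
  decides whether the horizontal edge leaves to the right or to the left.
\<close>
lemma EE_at:
  assumes "e \<in> EE n" "(x, y) \<in> e"
  shows "(e = {(x, y), (x + 1, y)} \<and> odd (x + y) \<and> x < y) \<or> (e = {(x - 1, y), (x, y)} \<and> even (x + y)) \<or>
    e = {(x, y), (x, y + 1)} \<or> e = {(x, y - 1), (x, y)} \<or>
    (x = y \<and> (e = {(x, x), (x + 1, x + 1)} \<or> e = {(x - 1, x - 1), (x, x)}))"
  using assms(1)
proof (cases rule: EE_cases)
  case (horizontal x' y')
  consider "x = x'" "y = y'" | "x = x' + 1" "y = y'" using assms(2) unfolding horizontal(1) by auto
  then show ?thesis
  proof cases
    case 1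
    then have "e = {(x, y), (x + 1, y)}" using horizontal(1) by simp
    moreover have "odd (x + y)" "x < y" using horizontal(4,6) 1 by simp_all
    ultimately show ?thesis by blast
  next
    case 2
    have "e = {(x - 1, y), (x, y)}" unfolding horizontal(1) 2 by simp
    moreover have "even (x + y)" using horizontal(6) 2 by presburger
    ultimately show ?thesis by blast
  qed
next
  case (vertical x' y')
  consider "x = x'" "y = y'" | "x = x'" "y = y' + 1" using assms(2) unfolding vertical(1) by auto
  then show ?thesis
  proof cases
    case 1
    then have "e = {(x, y), (x, y + 1)}" using vertical(1) by simp
    then show ?thesis by blast
  next
    case 2
    then have "e = {(x, y - 1), (x, y)}" using vertical(1) by simp
    then show ?thesis by blast
  qed
next
  case (diagonal x')
  consider "x = x'" "y = x'" | "x = x' + 1" "y = x' + 1" using assms(2) unfolding diagonal(1) by auto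
  then show ?thesis
  proof cases
    case 1
    then have "e = {(x, x), (x + 1, x + 1)}" "x = y" using diagonal(1) by simp_all
    then show ?thesis by blast
  next
    case 2
    then have "e = {(x - 1, x - 1), (x, x)}" "x = y" using diagonal(1) by simp_all
    then show ?thesis by blast
  qed
qed

text \<open>
  Indicator functions of the three kinds of edges, with values in the natural numbers so that parities can be
  added up. The function \<open>hor_above\<close> counts the horizontal edges of \<open>P\<close> that cross the upward ray from a point
  slightly to the right of \<open>(x, y)\<close>.
\<close>
definition hor :: "(int \<times> int) set set \<Rightarrow> int \<Rightarrow> int \<Rightarrow> nat" where
  "hor P x y = of_bool ({(x, y), (x + 1, y)} \<in> P)"
definition ver :: "(int \<times> int) set set \<Rightarrow> int \<Rightarrow> int \<Rightarrow> nat" where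
  "ver P x y = of_bool ({(x, y), (x, y + 1)} \<in> P)"
definition dia :: "(int \<times> int) set set \<Rightarrow> int \<Rightarrow> nat" where
  "dia P x = of_bool ({(x, x), (x + 1, x + 1)} \<in> P)"
definition hor_above :: "nat \<Rightarrow> (int \<times> int) set set \<Rightarrow> int \<Rightarrow> int \<Rightarrow> nat" where
  "hor_above n P x y = (\<Sum>y'\<in>{y<..2 * int n + 1}. hor P x y')"

lemma card_of_bool: "card {e \<in> P. e = A} = of_bool (A \<in> P)"
proof -
  have "{e \<in> P. e = A} = (if A \<in> P then {A} else {})" by auto
  then show ?thesis by simp
qed

lemma deg_off_diagonal:
  assumes "P \<subseteq> EE n" "x < y"
  shows "deg P (x, y) = hor P (x - 1) y + hor P x y + ver P x y + ver P x (y - 1)"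
proof -
  have fin: "finite P" using assms finite_EE finite_subset by blast
  have "{e \<in> P. (x, y) \<in> e} = {e \<in> P. e = {(x - 1, y), (x, y)}} \<union> ({e \<in> P. e = {(x, y), (x + 1, y)}} \<union>
     ({e \<in> P. e = {(x, y), (x, y + 1)}} \<union> {e \<in> P. e = {(x, y - 1), (x, y)}}))"
    (is "?L = ?R")
  proof
    show "?L \<subseteq> ?R"
    proof
      fix e assume "e \<in> ?L"
      then have e: "e \<in> P" "(x, y) \<in> e" by simp_all
      have "e = {(x - 1, y), (x, y)} \<or> e = {(x, y), (x + 1, y)} \<or> e = {(x, y), (x, y + 1)} \<or> e = {(x, y - 1), (x, y)}"
        using EE_at[OF subsetD[OF assms(1) e(1)] e(2)] less_imp_neq[OF assms(2)] by argo
      then show "e \<in> ?R" using e(1) by simp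
    qed
    show "?R \<subseteq> ?L" by auto
  qed
  then have "deg P (x, y) = card {e \<in> P. e = {(x - 1, y), (x, y)}} + (card {e \<in> P. e = {(x, y), (x + 1, y)}} +
     (card {e \<in> P. e = {(x, y), (x, y + 1)}} + card {e \<in> P. e = {(x, y - 1), (x, y)}}))"
    unfolding deg_def using fin
    by (simp, subst card_Un_disjoint, simp, simp, force simp: doubleton_eq_iff,
       subst card_Un_disjoint, simp, simp, force simp: doubleton_eq_iff,
       subst card_Un_disjoint, simp, simp, force simp: doubleton_eq_iff, simp)
  then show ?thesis unfolding card_of_bool hor_def ver_def by simp
qed

lemma deg_diagonal:
  assumes "P \<subseteq> EE n"
  shows "deg P (x, x) = hor P (x - 1) x + ver P x x + dia P x + dia P (x - 1)"
proof -
  have fin: "finite P" using assms finite_EE finite_subset by blast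
  have *: "{(x, x - 1), (x, x)} \<notin> EE n"
    by (auto elim!: EE_cases simp: doubleton_eq_iff)
  have "{e \<in> P. (x, x) \<in> e} = {e \<in> P. e = {(x - 1, x), (x, x)}} \<union> ({e \<in> P. e = {(x, x), (x, x + 1)}} \<union>
     ({e \<in> P. e = {(x, x), (x + 1, x + 1)}} \<union> {e \<in> P. e = {(x - 1, x - 1), (x, x)}}))"
    (is "?L = ?R")
  proof
    show "?L \<subseteq> ?R"
    proof
      fix e assume "e \<in> ?L"
      then have e: "e \<in> P" "(x, x) \<in> e" by simp_all
      then have "e \<in> EE n" using assms by blast
      then have "e \<noteq> {(x, x - 1), (x, x)}" using * by metis
      then have "e = {(x - 1, x), (x, x)} \<or> e = {(x, x), (x, x + 1)} \<or> e = {(x, x), (x + 1, x + 1)} \<or> e = {(x - 1, x - 1), (x, x)}"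
        using EE_at[OF \<open>e \<in> EE n\<close> e(2)] less_irrefl[of x] by argo
      then show "e \<in> ?R" using e(1) by simp
    qed
    show "?R \<subseteq> ?L" by auto
  qed
  then have "deg P (x, x) = card {e \<in> P. e = {(x - 1, x), (x, x)}} + (card {e \<in> P. e = {(x, x), (x, x + 1)}} +
     (card {e \<in> P. e = {(x, x), (x + 1, x + 1)}} + card {e \<in> P. e = {(x - 1, x - 1), (x, x)}}))"
    unfolding deg_def using fin
    by (simp, subst card_Un_disjoint, simp, simp, force simp: doubleton_eq_iff,
       subst card_Un_disjoint, simp, simp, force simp: doubleton_eq_iff,
       subst card_Un_disjoint, simp, simp, force simp: doubleton_eq_iff, simp)
  then show ?thesis unfolding card_of_bool hor_def ver_def dia_def by simp
qed

lemma hor_above_step: "y \<le> 2 * int n + 1 \<Longrightarrow> hor_above n P x (y - 1) = hor P x y + hor_above n P x y"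
proof -
  assume "y \<le> 2 * int n + 1"
  then have "{y - 1<..2 * int n + 1} = insert y {y<..2 * int n + 1}" by auto
  then show ?thesis unfolding hor_above_def by simp
qed

text \<open>
  Add the degrees in column \<open>x\<close> above height \<open>y\<close>. A vertical edge is counted twice, except
  for the one that leaves \<open>(x, y)\<close> upwards; the rest are the horizontal edges to both sides.
\<close>
lemma hor_above_column:
  assumes P: "P \<subseteq> EE n" and "x \<le> y" "y \<le> 2 * int n + 1"
  shows "even (hor_above n P (x - 1) y + hor_above n P x y + ver P x y + (\<Sum>y'\<in>{y<..2 * int n + 1}. deg P (x, y')))"
  using assms(3,2)
proof (induction y rule: int_le_induct)
  case base
  have "{(x, 2 * int n + 1), (x, 2 * int n + 1 + 1)} \<notin> EE n"
    by (auto elim!: EE_cases simp: doubleton_eq_iff)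
  then have "ver P x (2 * int n + 1) = 0" unfolding ver_def using P by auto
  then show ?case unfolding hor_above_def by simp
next
  case (step y)
  have "{y - 1<..2 * int n + 1} = insert y {y<..2 * int n + 1}" using step(1) by auto
  then have 1: "(\<Sum>y'\<in>{y - 1<..2 * int n + 1}. deg P (x, y')) = deg P (x, y) + (\<Sum>y'\<in>{y<..2 * int n + 1}. deg P (x, y'))"
    by simp
  have 2: "deg P (x, y) = hor P (x - 1) y + hor P x y + ver P x y + ver P x (y - 1)"
    using step by (intro deg_off_diagonal[OF P]) simp
  have "even (hor_above n P (x - 1) y + hor_above n P x y + ver P x y + (\<Sum>y'\<in>{y<..2 * int n + 1}. deg P (x, y')))"
    using step by simp
  then show ?case unfolding 1 2 hor_above_step[OF step(1)] by simp argo
qed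

text \<open>
  The same count for a whole column, where the diagonal edges appear as well:
  the numbers of edges that enter the column from the left and leave it to the right differ, modulo 2, by the number
  of boundary vertices of \<open>P\<close> in the column.
\<close>
lemma hor_above_whole_column:
  assumes P: "P \<subseteq> EE n" and "x \<le> 2 * int n"
  shows "even (hor_above n P (x - 1) (x - 1) + dia P (x - 1) + (hor_above n P x x + dia P x)
    + (\<Sum>y\<in>{x..2 * int n + 1}. deg P (x, y)))"
proof -
  have "{x..2 * int n + 1} = insert x {x<..2 * int n + 1}" using assms(2) by auto
  then have 1: "(\<Sum>y\<in>{x..2 * int n + 1}. deg P (x, y)) = deg P (x, x) + (\<Sum>y\<in>{x<..2 * int n + 1}. deg P (x, y))" by simp
  have "even (hor_above n P (x - 1) x + hor_above n P x x + ver P x x + (\<Sum>y'\<in>{x<..2 * int n + 1}. deg P (x, y')))"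
    using assms by (intro hor_above_column) auto
  moreover have "hor_above n P (x - 1) (x - 1) = hor P (x - 1) x + hor_above n P (x - 1) x"
    using assms by (intro hor_above_step) simp
  ultimately show ?thesis unfolding 1 deg_diagonal[OF P] by simp argo
qed

text \<open>
  A discrete Jordan curve argument. Suppose that \<open>P\<close> joins column 0 with \<open>(j, j)\<close>, and call the side of a vertex
  the parity of the number of edges of \<open>P\<close> above it. As \<open>P\<close> has no boundary vertex above the diagonal in a column
  other than column 0, this parity is constant along every edge that is disjoint from \<open>P\<close>. It is odd at \<open>(i, i)\<close> with \<open>i < j\<close>,
  because \<open>P\<close> has to cross from column \<open>i\<close> to column \<open>i + 1\<close> and can do so only above \<open>(i, i)\<close>, and it is
  even in the last column. The edges of \<open>Q\<close> on the odd side would therefore have the single boundary vertex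
  \<open>(i, i)\<close>, contrary to the handshake lemma.
\<close>
lemma noncrossing:
  assumes P: "P \<subseteq> EE n" and Q: "Q \<subseteq> EE n" and disj: "\<Union>P \<inter> \<Union>Q = {}"
    and oP: "odd_verts P = {(0, y), (j, j)}" and oQ: "odd_verts Q = {(i, i), (2 * int n, z)}"
    and y: "0 \<le> y" "y \<le> 2 * int n + 1" and ij: "0 \<le> i" "i < j" "j \<le> 2 * int n - 1"
  shows False
proof -
  have oddP: "odd (deg P v) \<longleftrightarrow> v = (0, y) \<or> v = (j, j)" for v using oP unfolding odd_verts_def by blast
  have oddQ: "odd (deg Q v) \<longleftrightarrow> v = (i, i) \<or> v = (2 * int n, z)" for v using oQ unfolding odd_verts_def by blast
  have evenP: "even (deg P v) \<longleftrightarrow> v \<noteq> (0, y) \<and> v \<noteq> (j, j)" for v using oddP by blast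
  have fin: "finite P" "finite Q" using P Q finite_EE finite_subset by blast+
  \<comment> \<open>Column 0 contains one boundary vertex of \<open>P\<close>, and there is no other before column \<open>j\<close>.\<close>
  have crossing: "odd (hor_above n P x x + dia P x)" if "0 \<le> x" "x < j" for x
    using that
  proof (induction x rule: int_ge_induct)
    case base
    have "{(-1, y), (0, y)} \<notin> EE n" for y by (auto elim!: EE_cases simp: doubleton_eq_iff)
    then have "hor P (-1) y = 0" for y unfolding hor_def using P by auto
    moreover have "{(-1, -1), (0, 0)} \<notin> EE n" by (auto elim!: EE_cases simp: doubleton_eq_iff)
    then have "dia P (-1) = 0" unfolding dia_def using P by auto
    moreover have "{y'\<in>{0..2 * int n + 1}. odd (deg P (0, y'))} = {y}" using oddP ij y by auto
    then have "odd (\<Sum>y\<in>{0..2 * int n + 1}. deg P (0, y))" by (simp add: even_sum_iff)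
    ultimately show ?case using hor_above_whole_column[OF P, of 0] by (simp add: hor_above_def)
  next
    case (step x)
    have "even (\<Sum>y\<in>{x + 1..2 * int n + 1}. deg P (x + 1, y))"
      using step by (intro dvd_sum) (simp add: evenP)
    then show ?case using hor_above_whole_column[OF P, of "x + 1"] step ij by simp
  qed
  have out: "hor P x y = 0" "hor P (x - 1) y = 0" "ver P x y = 0" if "(x, y) \<notin> \<Union>P" for x y
    unfolding hor_def ver_def using that by auto
  have evencol: "even (hor_above n P x y + hor_above n P (x + 1) y)"
    if "(x + 1, y) \<notin> \<Union>P" "x + 1 \<le> y" "y \<le> 2 * int n + 1" "0 \<le> x" for x y
  proof -
    have "even (\<Sum>y'\<in>{y<..2 * int n + 1}. deg P (x + 1, y'))"
      using that by (intro dvd_sum) (auto simp: evenP)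
    then show ?thesis using hor_above_column[OF P that(2,3)] out(3)[OF that(1)] by simp
  qed
  define side where "side v \<longleftrightarrow> odd (hor_above n P (fst v) (snd v))" for v
  have const: "side u = side v" if "e \<in> EE n" "e \<inter> \<Union>P = {}" "u \<in> e" "v \<in> e" for e u v
  proof -
    have "\<exists>p. \<forall>w\<in>e. side w = p"
      using that(1)
    proof (cases rule: EE_cases)
      case (horizontal x y)
      then show ?thesis using evencol[of x y] that(2) unfolding side_def by auto
    next
      case (vertical x y)
      then have "hor P x (y + 1) = 0" using out(1)[of x "y + 1"] that(2) by auto
      then show ?thesis using hor_above_step[of "y + 1" n P x] vertical unfolding side_def by auto
    next
      case (diagonal x)
      then have "(x + 1, x + 1) \<notin> \<Union>P" using that(2) by auto
      moreover have "hor P x (x + 1) = 0" using out(2)[OF calculation] by simp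
      ultimately show ?thesis
        using evencol[of x "x + 1"] hor_above_step[of "x + 1" n P x] diagonal unfolding side_def by auto
    qed
    then show ?thesis using that by auto
  qed
  \<comment> \<open>At each vertex, \<open>Q'\<close> contains all edges of \<open>Q\<close> or none.\<close>
  define Q' where "Q' = {e \<in> Q. \<forall>v\<in>e. side v}"
  have "deg Q' v = (if side v then deg Q v else 0)" for v
  proof -
    have "{e \<in> Q'. v \<in> e} = (if side v then {e \<in> Q. v \<in> e} else {})"
    proof -
      have "side u = side v" if "e \<in> Q" "v \<in> e" "u \<in> e" for e u
        using const[of e u v] that Q disj by blast
      then show ?thesis unfolding Q'_def by auto
    qed
    then show ?thesis unfolding deg_def by auto
  qed
  moreover have "{(2 * int n, y), (2 * int n + 1, y)} \<notin> EE n" for y by (auto elim!: EE_cases simp: doubleton_eq_iff)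
  then have "hor P (2 * int n) y = 0" for y unfolding hor_def using P by auto
  then have "\<not> side (2 * int n, z)" unfolding side_def hor_above_def by simp
  moreover have "side (i, i)"
  proof -
    have "(i, i) \<in> \<Union>Q" using oddQ[of "(i, i)"] deg_pos[OF fin(2)] by (auto dest: odd_pos)
    then have "(i, i) \<notin> \<Union>P" using disj by blast
    then have "dia P i = 0" unfolding dia_def by auto
    then show ?thesis using crossing[of i] ij unfolding side_def by simp
  qed
  ultimately have "odd_verts Q' = {(i, i)}" unfolding odd_verts_def using oddQ by auto
  moreover have "even (card (odd_verts Q'))"
    using Q card_EE fin by (intro even_card_odd_verts) (auto simp: Q'_def)
  ultimately show False by simp
qed

section \<open>Deleting two columns gives the next smaller graph\<close>

text \<open>
  The two vertices at the upper right, one of which is \<open>b\<close>. For even \<open>n\<close> the tip has the corner as its only neighbour; for odd \<open>n\<close> it is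
  not a vertex of \<open>G\<^sub>n\<close>.
\<close>
definition corner :: "nat \<Rightarrow> int \<times> int" where "corner n = (2 * int n, 2 * int n)"
definition tip :: "nat \<Rightarrow> int \<times> int" where "tip n = (2 * int n, 2 * int n + 1)"
definition core :: "nat \<Rightarrow> (int \<times> int) set" where "core n = VV n - {tip n}"

lemma EE_nonempty: "{} \<notin> EE n"
  using card_EE[of "{}" n] by auto

lemma bvert_eq: "bvert n = (if even n then tip n else corner n)"
proof -
  have "int n mod 2 = (if even n then 0 else 1)" by presburger
  then show ?thesis unfolding bvert_def tip_def corner_def by simp
qed

lemma pendant_corner:
  assumes "even n" "corner n \<in> W" "tip n \<in> W"
  shows "card (matchings (EE n) W) = card (matchings (EE n) (W - {corner n, tip n}))"
proof (rule card_matchings_forced)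
  have "int n mod 2 = 0" using assms(1) by presburger
  then show "{corner n, tip n} \<in> EE n" unfolding corner_def tip_def by (intro vertical_edge) auto
  fix M assume M: "M \<in> matchings (EE n) W"
  obtain e where e: "e \<in> M" "tip n \<in> e" "e \<in> EE n" "e \<subseteq> W" by (rule matchings_cover[OF M assms(3)])
  have sub: "e \<subseteq> VV n" using EE_subset_VV[OF e(3)] .
  have "e = {corner n, tip n}"
    using EE_at[OF e(3) e(2)[unfolded tip_def]] sub
    by (elim disjE conjE) (auto simp: mem_VV corner_def tip_def)
  then show "{corner n, tip n} \<in> M" using e(1) by simp
qed (use assms card_EE in auto)

lemma corner_in: "corner n \<in> VV n" unfolding corner_def by (auto simp: mem_VV)
lemma tip_in: "tip n \<in> VV n \<longleftrightarrow> even n" unfolding tip_def by (auto simp: mem_VV)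

text \<open>
  For even \<open>n\<close> the tip either is deleted or takes the corner with it, for odd \<open>n\<close> it is absent. Thus all the
  counts can be taken in the core, where the two parities of \<open>n\<close> differ only by a change of roles:
  deleting \<open>b\<close> restores the corner for even \<open>n\<close> and removes it for odd \<open>n\<close>.
\<close>
lemma Z_del_core:
  assumes "corner n \<notin> S" "tip n \<notin> S"
  shows "Z_del n S = (if even n then card (matchings (EE n) (core n - S - {corner n})) else card (matchings (EE n) (core n - S)))"
    and "Z_del n (insert (bvert n) S) = (if even n then card (matchings (EE n) (core n - S)) else card (matchings (EE n) (core n - S - {corner n})))"
proof -
  have "even n \<Longrightarrow> VV n - S - {corner n, tip n} = core n - S - {corner n}" unfolding core_def by auto
  moreover have "odd n \<Longrightarrow> core n = VV n" unfolding core_def using tip_in by auto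
  ultimately show "Z_del n S = (if even n then card (matchings (EE n) (core n - S - {corner n})) else card (matchings (EE n) (core n - S)))"
    unfolding Z_del_eq_matchings using pendant_corner[of n "VV n - S"] assms corner_in tip_in by auto
  have "even n \<Longrightarrow> VV n - insert (bvert n) S = core n - S" unfolding core_def bvert_eq by auto
  moreover have "odd n \<Longrightarrow> VV n - insert (bvert n) S = core n - S - {corner n}" unfolding core_def bvert_eq using tip_in by auto
  ultimately show "Z_del n (insert (bvert n) S) = (if even n then card (matchings (EE n) (core n - S)) else card (matchings (EE n) (core n - S - {corner n})))"
    unfolding Z_del_eq_matchings by simp
qed

definition shift :: "int \<times> int \<Rightarrow> int \<times> int" where "shift v = (fst v + 2, snd v + 2)"

lemma shift_pair [simp]: "shift (x, y) = (x + 2, y + 2)" by (simp add: shift_def)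

lemma inj_shift: "inj shift" unfolding shift_def by (rule injI) (simp add: prod_eq_iff)

text \<open>
  The edge sets agree under the translation by (2,2), up to the edge between corner and tip, which is present only for
  one of the two parities of the index; a set \<open>W\<close> inside the core does not contain the tip.
\<close>
lemma shift_edges:
  assumes W: "W \<subseteq> core m"
  shows "{e \<in> EE (Suc m). e \<subseteq> shift ` W} = (`) shift ` {e \<in> EE m. e \<subseteq> W}"
proof
  have notp: "(2 * int m, 2 * int m + 1) \<notin> W" using W unfolding core_def tip_def by auto
  have WV: "v \<in> W \<Longrightarrow> v \<in> VV m" for v using W unfolding core_def by auto
  show "(`) shift ` {e \<in> EE m. e \<subseteq> W} \<subseteq> {e \<in> EE (Suc m). e \<subseteq> shift ` W}"
  proof
    fix e' assume "e' \<in> (`) shift ` {e \<in> EE m. e \<subseteq> W}"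
    then obtain e where e: "e' = shift ` e" "e \<in> EE m" "e \<subseteq> W" by auto
    have "e' \<in> EE (Suc m)"
      using e(2)
    proof (cases rule: EE_cases)
      case (horizontal x y)
      then have "{(x + 2, y + 2), (x + 2 + 1, y + 2)} \<in> EE (Suc m)" by (intro horizontal_edge) auto
      then show ?thesis unfolding e(1) horizontal(1) by (simp add: algebra_simps)
    next
      case (vertical x y)
      have "x \<noteq> 2 * int m"
      proof
        assume "x = 2 * int m"
        then have "(2 * int m, 2 * int m + 1) \<in> W" using vertical e(3) by auto
        then show False using notp by simp
      qed
      then have "{(x + 2, y + 2), (x + 2, y + 2 + 1)} \<in> EE (Suc m)"
        using vertical(2-5) by (intro vertical_edge) (simp_all, presburger?)
      then show ?thesis unfolding e(1) vertical(1) by (simp add: algebra_simps)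
    next
      case (diagonal x)
      then have "{(x + 2, x + 2), (x + 2 + 1, x + 2 + 1)} \<in> EE (Suc m)" by (intro diagonal_edge) auto
      then show ?thesis unfolding e(1) diagonal(1) by (simp add: algebra_simps)
    qed
    then show "e' \<in> {e \<in> EE (Suc m). e \<subseteq> shift ` W}" using e by auto
  qed
  show "{e \<in> EE (Suc m). e \<subseteq> shift ` W} \<subseteq> (`) shift ` {e \<in> EE m. e \<subseteq> W}"
  proof
    fix e' assume "e' \<in> {e \<in> EE (Suc m). e \<subseteq> shift ` W}"
    then have e': "e' \<in> EE (Suc m)" "e' \<subseteq> shift ` W" by auto
    have W': "(x - 2, y - 2) \<in> W" if "(x, y) \<in> e'" for x y
    proof -
      have "(x, y) \<in> shift ` W" using that e'(2) by blast
      then obtain v where "v \<in> W" "(x, y) = shift v" by blast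
      then show ?thesis unfolding shift_def by (cases v) simp
    qed
    have "\<exists>e. e \<in> EE m \<and> e' = shift ` e"
      using e'(1)
    proof (cases rule: EE_cases)
      case (horizontal x y)
      have "(x - 2, y - 2) \<in> VV m" "(x + 1 - 2, y - 2) \<in> VV m" using WV[OF W'[of x y]] WV[OF W'[of "x + 1" y]] unfolding horizontal(1) by simp_all
      then have "{(x - 2, y - 2), (x - 2 + 1, y - 2)} \<in> EE m"
        using horizontal by (intro horizontal_edge) (auto simp: mem_VV)
      moreover have "e' = shift ` {(x - 2, y - 2), (x - 2 + 1, y - 2)}" unfolding horizontal(1) by (simp add: add.commute)
      ultimately show ?thesis by blast
    next
      case (vertical x y)
      have v: "(x - 2, y - 2) \<in> W" "(x - 2, y + 1 - 2) \<in> W" using W'[of x y] W'[of x "y + 1"] unfolding vertical(1) by simp_all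
      then have vV: "(x - 2, y - 2) \<in> VV m" "(x - 2, y + 1 - 2) \<in> VV m" using WV by auto
      \<comment> \<open>excludes the edge between corner and tip, whose presence depends on the parity\<close>
      have "x - 2 \<noteq> 2 * int m"
      proof
        assume x: "x - 2 = 2 * int m"
        then have y: "y + 1 - 2 = 2 * int m + 1" using vV by (auto simp: mem_VV)
        show False using notp v(2) unfolding x y by simp
      qed
      then have "{(x - 2, y - 2), (x - 2, y - 2 + 1)} \<in> EE m"
        using vertical vV by (intro vertical_edge) (simp_all add: mem_VV, presburger?)
      moreover have "e' = shift ` {(x - 2, y - 2), (x - 2, y - 2 + 1)}" unfolding vertical(1) by (simp add: add.commute)
      ultimately show ?thesis by blast
    next
      case (diagonal x)
      have "(x - 2, x - 2) \<in> VV m" "(x + 1 - 2, x + 1 - 2) \<in> VV m" using WV[OF W'[of x x]] WV[OF W'[of "x + 1" "x + 1"]] unfolding diagonal(1) by simp_all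
      then have "{(x - 2, x - 2), (x - 2 + 1, x - 2 + 1)} \<in> EE m"
        using diagonal by (intro diagonal_edge) (auto simp: mem_VV)
      moreover have "e' = shift ` {(x - 2, x - 2), (x - 2 + 1, x - 2 + 1)}" unfolding diagonal(1) by (simp add: add.commute)
      ultimately show ?thesis by blast
    qed
    then obtain e where e: "e \<in> EE m" "e' = shift ` e" by blast
    have "e \<subseteq> W" using e'(2) unfolding e(2) by (simp add: inj_image_subset_iff[OF inj_shift])
    then show "e' \<in> (`) shift ` {e \<in> EE m. e \<subseteq> W}" using e by blast
  qed
qed

lemma matchings_shift: "W \<subseteq> core m \<Longrightarrow> card (matchings (EE (Suc m)) (shift ` W)) = card (matchings (EE m) W)"
  by (rule matchings_image[OF inj_shift shift_edges])

definition left_part :: "nat \<Rightarrow> (int \<times> int) set" where "left_part n = {v \<in> VV n. fst v \<le> 1}"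
definition right_part :: "nat \<Rightarrow> (int \<times> int) set" where "right_part n = {v \<in> VV n. fst v \<ge> 2}"

lemma shift_core: "shift ` core m = right_part (Suc m) - {tip (Suc m)}"
proof (intro set_eqI iffI)
  fix v assume "v \<in> shift ` core m"
  then show "v \<in> right_part (Suc m) - {tip (Suc m)}"
    unfolding core_def right_part_def tip_def by (auto simp: mem_VV)
next
  fix v assume v: "v \<in> right_part (Suc m) - {tip (Suc m)}"
  obtain x y where xy: "v = (x, y)" by (cases v)
  have "(x - 2, y - 2) \<in> core m" using v unfolding xy core_def right_part_def tip_def by (auto simp: mem_VV)
  then have "shift (x - 2, y - 2) \<in> shift ` core m" by (rule imageI)
  then show "v \<in> shift ` core m" unfolding xy by simp
qed

lemma shift_corner: "shift (corner m) = corner (Suc m)" unfolding corner_def by simp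

text \<open>
  Passing from \<open>G\<^bsub>m+1\<^esub>\<close> to \<open>G\<^sub>m\<close> changes the parity of the index, hence by \<open>Z_del_core\<close> it exchanges
  "\<open>b\<close> present" with "\<open>b\<close> deleted".
\<close>
lemma Z_del_right_part:
  assumes S: "corner m \<notin> S" "tip m \<notin> S" "S \<subseteq> core m"
  shows "card (matchings (EE (Suc m)) (right_part (Suc m) - shift ` S)) = Z_del m (insert (bvert m) S)"
    and "card (matchings (EE (Suc m)) (right_part (Suc m) - insert (bvert (Suc m)) (shift ` S))) = Z_del m S"
proof -
  let ?E = "EE (Suc m)" and ?t = "corner (Suc m)" and ?p = "tip (Suc m)" and ?R = "right_part (Suc m)"
  have A: "shift ` (core m - S) = ?R - {?p} - shift ` S"
    unfolding image_set_diff[OF inj_shift] shift_core ..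
  have B: "shift ` (core m - S - {corner m}) = ?R - {?p} - shift ` S - {?t}"
    unfolding image_set_diff[OF inj_shift] shift_core by (simp add: shift_corner)
  have cA: "card (matchings ?E (?R - {?p} - shift ` S)) = card (matchings (EE m) (core m - S))"
    unfolding A[symmetric] by (rule matchings_shift) auto
  have cB: "card (matchings ?E (?R - {?p} - shift ` S - {?t})) = card (matchings (EE m) (core m - S - {corner m}))"
    unfolding B[symmetric] by (rule matchings_shift) auto
  have tS: "?t \<notin> shift ` S" using S(1) unfolding shift_corner[symmetric] by (simp add: inj_image_mem_iff[OF inj_shift])
  have pS: "?p \<notin> shift ` S" using S(3) shift_core[of m] by blast
  have tR: "?t \<in> ?R" using corner_in[of "Suc m"] unfolding right_part_def corner_def by auto
  have pR: "?p \<in> ?R \<longleftrightarrow> odd m" using tip_in[of "Suc m"] unfolding right_part_def tip_def by auto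
  show "card (matchings ?E (?R - shift ` S)) = Z_del m (insert (bvert m) S)"
  proof (cases "even m")
    case True
    then have "?R - shift ` S = ?R - {?p} - shift ` S" using pR by auto
    then show ?thesis using cA True Z_del_core(2)[OF S(1,2)] by simp
  next
    case False
    have "?R - shift ` S - {?t, ?p} = ?R - {?p} - shift ` S - {?t}" by auto
    then show ?thesis using cB False Z_del_core(2)[OF S(1,2)] pendant_corner[of "Suc m" "?R - shift ` S"] tS pS tR pR by simp
  qed
  show "card (matchings ?E (?R - insert (bvert (Suc m)) (shift ` S))) = Z_del m S"
  proof (cases "even m")
    case True
    then have "?R - insert (bvert (Suc m)) (shift ` S) = ?R - {?p} - shift ` S - {?t}" using pR unfolding bvert_eq by auto
    then show ?thesis using cB True Z_del_core(1)[OF S(1,2)] by simp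
  next
    case False
    then have "?R - insert (bvert (Suc m)) (shift ` S) = ?R - {?p} - shift ` S" unfolding bvert_eq by auto
    then show ?thesis using cA False Z_del_core(1)[OF S(1,2)] by simp
  qed
qed

section \<open>Matchings of the columns 0 and 1\<close>

text \<open>
  The vertices of column 2 that have a neighbour in the columns 0 and 1; (2,2) is reached by a diagonal edge as well.
\<close>
definition gate :: "nat \<Rightarrow> (int \<times> int) set" where
  "gate n = {(x, y). x = 2 \<and> 2 \<le> y \<and> y \<le> 2 * int n + 1 \<and> even y}"

definition sgn_vertex :: "int \<times> int \<Rightarrow> int" where
  "sgn_vertex v = (if even (fst v + snd v) then 1 else -1)"

text \<open>
  Column 1 cancels column 0 except for the vertex (0,0).
\<close>
lemma sum_sgn_left_part:
  assumes "n \<ge> 1"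
  shows "sum sgn_vertex (left_part n) = 1"
proof -
  let ?N = "2 * int n + 1"
  have L: "left_part n = Pair 0 ` {0..?N} \<union> Pair 1 ` {1..?N}"
    using assms unfolding left_part_def by (force simp: mem_VV image_iff)
  have "sum sgn_vertex (left_part n) = sum sgn_vertex (Pair 0 ` {0..?N}) + sum sgn_vertex (Pair 1 ` {1..?N})"
    unfolding L by (rule sum.union_disjoint) auto
  also have "\<dots> = (\<Sum>y\<in>{0..?N}. sgn_vertex (0, y)) + (\<Sum>y\<in>{1..?N}. sgn_vertex (1, y))"
    by (simp add: sum.reindex inj_on_def)
  also have "{0..?N} = insert 0 {1..?N}" by auto
  also have "(\<Sum>y\<in>insert 0 {1..?N}. sgn_vertex (0, y)) = 1 + (\<Sum>y\<in>{1..?N}. sgn_vertex (0, y))"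
    by (simp add: sgn_vertex_def)
  also have "(\<Sum>y\<in>{1..?N}. sgn_vertex (1, y)) = (\<Sum>y\<in>{1..?N}. - sgn_vertex (0, y))"
    by (rule sum.cong) (auto simp: sgn_vertex_def)
  finally show ?thesis by (simp add: sum_negf)
qed

lemma finite_gate: "finite (gate n)"
  by (rule finite_subset[of _ "{2} \<times> {2..2 * int n + 1}"]) (auto simp: gate_def)

lemma gate_subset_right: "n \<ge> 1 \<Longrightarrow> gate n \<subseteq> right_part n"
  unfolding gate_def right_part_def by (auto simp: mem_VV)

text \<open>
  The gate vertices all have sign 1, so the signs in \<open>left_part n \<union> Y\<close> add up to \<open>1 + card Y\<close>. Every edge contributes 0, except that a
  diagonal edge contributes 2. The two diagonal edges available share (1,1), so that at most one is used, whence
  \<open>1 + card Y = 2\<close>.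
\<close>
lemma one_passes_gate:
  assumes n: "n \<ge> 1" and Y: "Y \<subseteq> gate n" and ne: "matchings (EE n) (left_part n \<union> Y) \<noteq> {}"
  shows "card Y = 1"
proof -
  obtain M where M: "M \<in> matchings (EE n) (left_part n \<union> Y)" using ne by blast
  have finM: "finite M" using M finite_EE[of n] finite_subset unfolding matchings_def by blast
  have finY: "finite Y" using Y finite_gate finite_subset by blast
  have finL: "finite (left_part n)" unfolding left_part_def using finite_VV by simp
  \<comment> \<open>the only diagonal edges within the columns 0 to 2\<close>
  define Dg :: "(int \<times> int) set set" where "Dg = {{(0, 0), (1, 1)}, {(1, 1), (2, 2)}}"
  have e: "sum sgn_vertex e = 2 * of_bool (e \<in> Dg)" if "e \<in> M" for e
  proof -
    have eE: "e \<in> EE n" "e \<subseteq> left_part n \<union> Y" using matchings_edge[OF M that] by auto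
    have cols: "x \<le> 2" if "(x, y) \<in> e" for x y
      using that eE(2) Y unfolding left_part_def gate_def by force
    show ?thesis using eE(1)
    proof (cases rule: EE_cases)
      case (horizontal x y)
      then have "e \<notin> Dg" unfolding Dg_def by (auto simp: doubleton_eq_iff)
      then show ?thesis unfolding horizontal(1) by (simp add: sgn_vertex_def)
    next
      case (vertical x y)
      then have "e \<notin> Dg" unfolding Dg_def by (auto simp: doubleton_eq_iff)
      then show ?thesis unfolding vertical(1) by (simp add: sgn_vertex_def)
    next
      case (diagonal x)
      then have "x = 0 \<or> x = 1" using cols[of "x + 1" "x + 1"] by auto
      then have "e \<in> Dg" unfolding Dg_def diagonal(1) by auto
      then show ?thesis unfolding diagonal(1) by (simp add: sgn_vertex_def)
    qed
  qed
  have cov: "\<Union>M = left_part n \<union> Y" using M unfolding matchings_def by auto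
  have "card (M \<inter> Dg) \<le> 1"
  proof -
    have "e = f" if "e \<in> M \<inter> Dg" "f \<in> M \<inter> Dg" for e f
      using matchings_unique[OF M, of e f "(1, 1)"] that unfolding Dg_def by auto
    then show ?thesis using finM by (simp add: card_le_Suc0_iff_eq)
  qed
  moreover have "1 + int (card Y) = 2 * int (card (M \<inter> Dg))"
  proof -
    have "sum sgn_vertex Y = (\<Sum>v\<in>Y. 1)"
      using Y by (intro sum.cong) (auto simp: gate_def sgn_vertex_def)
    moreover have "left_part n \<inter> Y = {}" using Y unfolding left_part_def gate_def by auto
    ultimately have "1 + int (card Y) = sum sgn_vertex (left_part n \<union> Y)"
      using finL finY sum_sgn_left_part[OF n] by (simp add: sum.union_disjoint)
    also have "\<dots> = (\<Sum>e\<in>M. sum sgn_vertex e)"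
      unfolding cov[symmetric]
    proof (subst sum.Union_disjoint)
      show "\<forall>A\<in>M. finite A" using matchings_edge[OF M] finL finY finite_subset by blast
      show "\<forall>A\<in>M. \<forall>B\<in>M. A \<noteq> B \<longrightarrow> A \<inter> B = {}" using matchings_unique[OF M] by blast
    qed simp
    also have "\<dots> = (\<Sum>e\<in>M. 2 * of_bool (e \<in> Dg))" using e by simp
    also have "\<dots> = 2 * int (card (M \<inter> Dg))"
      using finM by (simp add: sum_distrib_left[symmetric] of_bool_def sum.If_cases)
    finally show ?thesis .
  qed
  ultimately show ?thesis by presburger
qed

definition left_weight :: "nat \<Rightarrow> int \<times> int \<Rightarrow> nat" where
  "left_weight n v = card (matchings (EE n) (insert v (left_part n)))"

lemma edge_left_gate:
  assumes "e \<in> EE n" "e \<inter> left_part n \<noteq> {}" "v \<in> e"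
  shows "v \<in> left_part n \<or> v \<in> gate n"
proof -
  have eV: "e \<subseteq> VV n" using EE_subset_VV[OF assms(1)] .
  then have vV: "v \<in> VV n" using assms(3) by blast
  show ?thesis
  proof (cases "fst v \<le> 1")
    case True
    then show ?thesis using vV unfolding left_part_def by simp
  next
    case False
    obtain u where u: "u \<in> e" "fst u \<le> 1" using assms(2) unfolding left_part_def by auto
    show ?thesis using assms(1)
    proof (cases rule: EE_cases)
      case (horizontal x y)
      then have "x = 1" "v = (2, y)" using u False assms(3) by auto
      then show ?thesis using horizontal by (auto simp: gate_def)
    next
      case (vertical x y)
      then show ?thesis using u False assms(3) by auto
    next
      case (diagonal x)
      then have "x = 1" "v = (2, 2)" using u False assms(3) by auto
      then show ?thesis using diagonal by (auto simp: gate_def)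
    qed
  qed
qed

text \<open>
  A transfer matrix step across the columns 0 and 1; by \<open>one_passes_gate\<close> only the states with one
  vertex contribute.
\<close>
lemma Z_del_cut_after_column_1:
  assumes n: "n \<ge> 1" and S: "\<And>v. v \<in> S \<Longrightarrow> fst v \<ge> 2"
  shows "Z_del n S = (\<Sum>v\<in>gate n - S. left_weight n v * card (matchings (EE n) (right_part n - insert v S)))"
proof -
  let ?E = "EE n" and ?L = "left_part n" and ?R = "right_part n - S" and ?F = "gate n - S"
  have LR: "VV n - S = ?L \<union> ?R" using S unfolding left_part_def right_part_def by force
  have "Z_del n S = (\<Sum>Y\<in>Pow ?F. card (matchings ?E (?L \<union> Y)) * card (matchings ?E (?R - Y)))"
    unfolding Z_del_eq_matchings LR
  proof (rule card_matchings_cut)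
    show "?L \<inter> ?R = {}" unfolding left_part_def right_part_def by auto
    show "finite ?E" "{} \<notin> ?E" "finite ?F" using finite_EE EE_nonempty finite_gate by auto
    show "?F \<subseteq> ?R" using gate_subset_right[OF n] by blast
    show "e \<subseteq> ?L \<union> ?F" if "e \<in> ?E" "e \<inter> ?L \<noteq> {}" "e \<subseteq> ?L \<union> ?R" for e
    proof
      fix v assume v: "v \<in> e"
      then have "v \<in> ?L \<or> v \<in> gate n" using edge_left_gate[OF that(1,2)] by blast
      then show "v \<in> ?L \<union> ?F" using v that(3) by blast
    qed
    show "\<not> e \<subseteq> ?F" if "e \<in> ?E" for e
      using that by (rule EE_cases) (auto simp: gate_def)
  qed
  also have "\<dots> = (\<Sum>Y\<in>(\<lambda>v. {v}) ` ?F. card (matchings ?E (?L \<union> Y)) * card (matchings ?E (?R - Y)))"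
  proof (rule sum.mono_neutral_right)
    show "finite (Pow ?F)" using finite_gate by simp
    show "(\<lambda>v. {v}) ` ?F \<subseteq> Pow ?F" by auto
    show "\<forall>Y\<in>Pow ?F - (\<lambda>v. {v}) ` ?F. card (matchings ?E (?L \<union> Y)) * card (matchings ?E (?R - Y)) = 0"
    proof
      fix Y assume Y: "Y \<in> Pow ?F - (\<lambda>v. {v}) ` ?F"
      have "matchings ?E (?L \<union> Y) = {}"
      proof (rule ccontr)
        assume "matchings ?E (?L \<union> Y) \<noteq> {}"
        moreover have "Y \<subseteq> gate n" using Y by auto
        ultimately have "card Y = 1" using one_passes_gate[OF n] by blast
        then obtain v where "Y = {v}" by (rule card_1_singletonE)
        then show False using Y by auto
      qed
      then show "card (matchings ?E (?L \<union> Y)) * card (matchings ?E (?R - Y)) = 0" by simp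
    qed
  qed
  also have "\<dots> = (\<Sum>v\<in>?F. card (matchings ?E (?L \<union> {v})) * card (matchings ?E (?R - {v})))"
    by (subst sum.reindex) (auto simp: inj_on_def)
  also have "\<dots> = (\<Sum>v\<in>?F. left_weight n v * card (matchings ?E (right_part n - insert v S)))"
    unfolding left_weight_def by (intro sum.cong refl) (simp add: Diff_insert2[symmetric] Diff_insert[symmetric])
  finally show ?thesis .
qed

text \<open>
  Without (1,1), the vertex (0,0) can only be matched upwards, and this propagates up the column: the vertices of even height
  have no horizontal edges.
\<close>
lemma column0_forced:
  assumes M: "M \<in> matchings (EE n) W" and W: "left_part n - {(1, 1)} \<subseteq> W" "(1, 1) \<notin> W" and k: "k \<le> n"
  shows "{(0, 2 * int k), (0, 2 * int k + 1)} \<in> M"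
  using k
proof (induction k)
  case 0
  have "(0, 0) \<in> W" using W unfolding left_part_def by (auto simp: mem_VV)
  then obtain e where e: "e \<in> M" "(0, 0) \<in> e" "e \<in> EE n" "e \<subseteq> W" by (rule matchings_cover[OF M])
  have eV: "e \<subseteq> VV n" using EE_subset_VV[OF e(3)] .
  have "e = {(0, 0), (0, 1)}"
    using EE_at[OF e(3,2)] eV e(4) W(2) by (elim disjE conjE) (auto simp: mem_VV)
  then show ?case using e(1) by simp
next
  case (Suc k)
  let ?y = "2 * int (Suc k)"
  have IH: "{(0, 2 * int k), (0, 2 * int k + 1)} \<in> M" using Suc by simp
  have "(0, ?y) \<in> W" using W Suc.prems unfolding left_part_def by (auto simp: mem_VV)
  then obtain e where e: "e \<in> M" "(0, ?y) \<in> e" "e \<in> EE n" "e \<subseteq> W" by (rule matchings_cover[OF M])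
  have eV: "e \<subseteq> VV n" using EE_subset_VV[OF e(3)] .
  have "e \<noteq> {(0, ?y - 1), (0, ?y)}"
  proof
    assume e2: "e = {(0, ?y - 1), (0, ?y)}"
    then have "e = {(0, 2 * int k), (0, 2 * int k + 1)}"
      using matchings_unique[OF M e(1) IH, of "(0, ?y - 1)"] by simp
    then show False using e2 by (auto simp: doubleton_eq_iff)
  qed
  then have "e = {(0, ?y), (0, ?y + 1)}"
    using EE_at[OF e(3,2)] eV by (elim disjE conjE) (auto simp: mem_VV)
  then show ?case using e(1) by simp
qed

text \<open>
  Once column 0 is matched within itself, the vertices of odd height in column 1 have only vertical edges. The
  top vertex can only be matched downwards, and this propagates down the column to height 2.
\<close>
lemma column1_forced:
  assumes M: "M \<in> matchings (EE n) W" and W: "left_part n - {(1, 1)} \<subseteq> W" "(1, 1) \<notin> W" and k: "1 \<le> k" "k \<le> n"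
  shows "{(1, 2 * int k), (1, 2 * int k + 1)} \<in> M"
  using k(2,1)
proof (induction k rule: inc_induct)
  case base
  let ?y = "2 * int n + 1"
  have "(1, ?y) \<in> W" using W base unfolding left_part_def by (auto simp: mem_VV)
  then obtain e where e: "e \<in> M" "(1, ?y) \<in> e" "e \<in> EE n" "e \<subseteq> W" by (rule matchings_cover[OF M])
  have eV: "e \<subseteq> VV n" using EE_subset_VV[OF e(3)] .
  have "e \<noteq> {(1 - 1, ?y), (1, ?y)}"
    using matchings_unique[OF M e(1) column0_forced[OF M W, of n], of "(0, ?y)"] by (auto simp: doubleton_eq_iff)
  then have "e = {(1, ?y - 1), (1, ?y)}"
    using EE_at[OF e(3,2)] eV base by (elim disjE conjE) (auto simp: mem_VV)
  then show ?case using e(1) by simp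
next
  case (step k)
  let ?y = "2 * int k + 1"
  have IH: "{(1, 2 * int (Suc k)), (1, 2 * int (Suc k) + 1)} \<in> M" using step by simp
  have "(1, ?y) \<in> W" using W step unfolding left_part_def by (auto simp: mem_VV)
  then obtain e where e: "e \<in> M" "(1, ?y) \<in> e" "e \<in> EE n" "e \<subseteq> W" by (rule matchings_cover[OF M])
  have eV: "e \<subseteq> VV n" using EE_subset_VV[OF e(3)] .
  have n1: "e \<noteq> {(1 - 1, ?y), (1, ?y)}"
    using matchings_unique[OF M e(1) column0_forced[OF M W, of k], of "(0, ?y)"] step by (auto simp: doubleton_eq_iff)
  have n2: "e \<noteq> {(1, ?y), (1, ?y + 1)}"
    using matchings_unique[OF M e(1) IH, of "(1, ?y + 1)"] by (auto simp: doubleton_eq_iff)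
  have "e = {(1, ?y - 1), (1, ?y)}"
    using EE_at[OF e(3,2)] eV n1 n2 step by (elim disjE conjE) (auto simp: mem_VV)
  then show ?case using e(1) by simp
qed

text \<open>
  The forced edges cover the columns 0 and 1, so these have one matching and no edge leaves them.
\<close>
lemma Z_del_frozen_columns:
  assumes n: "n \<ge> 1" and S: "S \<subseteq> right_part n"
  shows "Z_del n (insert (1, 1) S) = card (matchings (EE n) (right_part n - S))"
proof -
  let ?E = "EE n" and ?A = "left_part n - {(1, 1)}" and ?B = "right_part n - S"
  define f :: "int \<Rightarrow> int \<Rightarrow> (int \<times> int) set" where "f x k = {(x, 2 * k), (x, 2 * k + 1)}" for x k
  define M0 where "M0 = {f x k | x k. 0 \<le> x \<and> x \<le> 1 \<and> x \<le> k \<and> k \<le> int n}"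
  have AB: "VV n - insert (1, 1) S = ?A \<union> ?B" using S unfolding left_part_def right_part_def by auto
  have forced: "M0 \<subseteq> M" if M: "M \<in> matchings ?E W" and W: "?A \<subseteq> W" "(1, 1) \<notin> W" for M W
  proof
    fix e assume "e \<in> M0"
    then obtain x k where xk: "e = f x k" "0 \<le> x" "x \<le> 1" "x \<le> k" "k \<le> int n" unfolding M0_def by blast
    obtain k' where k': "k = int k'" using xk nonneg_int_cases[of k] by auto
    show "e \<in> M"
    proof (cases "x = 0")
      case True
      then show ?thesis using column0_forced[OF M W, of k'] xk k' unfolding f_def by simp
    next
      case False
      then have "x = 1" using xk by simp
      then show ?thesis using column1_forced[OF M W, of k'] xk k' unfolding f_def by simp
    qed
  qed
  have in_f: "(x, y) \<in> f x' k \<longleftrightarrow> x = x' \<and> k = y div 2" for x y x' k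
    unfolding f_def by auto
  have cover: "\<exists>e\<in>M0. v \<in> e" if v: "v \<in> ?A" for v
  proof -
    obtain x y where xy: "v = (x, y)" by (cases v)
    have "0 \<le> x \<and> x \<le> 1 \<and> x \<le> y div 2 \<and> y div 2 \<le> int n"
      using v unfolding xy left_part_def by (auto simp: mem_VV)
    then have "f x (y div 2) \<in> M0" unfolding M0_def by blast
    moreover have "v \<in> f x (y div 2)" unfolding xy in_f by simp
    ultimately show ?thesis by blast
  qed
  have M0A: "e \<subseteq> ?A \<and> e \<in> ?E" if e: "e \<in> M0" for e
  proof -
    obtain x k where xk: "e = f x k" "0 \<le> x" "x \<le> 1" "x \<le> k" "k \<le> int n" using e unfolding M0_def by blast
    have "e \<in> ?E" unfolding xk(1) f_def using xk n by (intro vertical_edge) auto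
    moreover have "e \<subseteq> ?A" unfolding xk(1) f_def left_part_def using xk n by (auto simp: mem_VV)
    ultimately show ?thesis by simp
  qed
  have M0_matchings: "M0 \<in> matchings ?E ?A"
  proof -
    have "\<exists>!e. e \<in> M0 \<and> v \<in> e" if v: "v \<in> ?A" for v
    proof -
      obtain e where e: "e \<in> M0" "v \<in> e" using cover[OF v] by blast
      have "e' = e" if e': "e' \<in> M0" "v \<in> e'" for e'
      proof -
        obtain x y where xy: "v = (x, y)" by (cases v)
        obtain x1 k1 where 1: "e = f x1 k1" using e unfolding M0_def by blast
        obtain x2 k2 where 2: "e' = f x2 k2" using e' unfolding M0_def by blast
        show ?thesis using e(2) e'(2) unfolding 1 2 xy in_f by simp
      qed
      then show ?thesis using e by blast
    qed
    moreover have "M0 \<subseteq> ?E" "\<Union>M0 \<subseteq> ?A" using M0A by blast+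
    ultimately show ?thesis unfolding matchings_def by simp
  qed
  have "matchings ?E ?A = {M0}"
  proof (intro set_eqI iffI)
    fix M assume M: "M \<in> matchings ?E ?A"
    have sub: "M0 \<subseteq> M" using forced[OF M] by blast
    have "e \<in> M0" if e: "e \<in> M" for e
    proof -
      obtain v where v: "v \<in> e" using matchings_edge[OF M e] EE_nonempty by (metis all_not_in_conv)
      then have "v \<in> ?A" using matchings_edge[OF M e] by blast
      then obtain e' where "e' \<in> M0" "v \<in> e'" using cover by blast
      then show ?thesis using matchings_unique[OF M e, of e' v] v sub by blast
    qed
    then show "M \<in> {M0}" using sub by blast
  qed (use M0_matchings in simp)
  moreover have "card (matchings ?E (?A \<union> ?B)) = card (matchings ?E ?A) * card (matchings ?E ?B)"
  proof (rule card_matchings_separated)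
    show "?A \<inter> ?B = {}" unfolding left_part_def right_part_def by auto
    show "{} \<notin> ?E" by (rule EE_nonempty)
    fix M e assume M: "M \<in> matchings ?E (?A \<union> ?B)" and e: "e \<in> M"
    have sub: "M0 \<subseteq> M" using forced[OF M] unfolding right_part_def by auto
    show "e \<subseteq> ?A \<or> e \<subseteq> ?B"
    proof (cases "e \<inter> ?A = {}")
      case True
      then show ?thesis using matchings_edge[OF M e] by blast
    next
      case False
      then obtain v where v: "v \<in> e" "v \<in> ?A" by blast
      then obtain e' where e': "e' \<in> M0" "v \<in> e'" using cover by blast
      then have "e = e'" using matchings_unique[OF M e, of e' v] v sub by blast
      then show ?thesis using M0A e' by blast
    qed
  qed
  ultimately show ?thesis unfolding Z_del_eq_matchings AB by simp
qed

section \<open>The strip along the diagonal\<close>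

definition diag :: "int \<Rightarrow> int \<times> int" where "diag k = (k, k)"
definition superdiag :: "int \<Rightarrow> int \<times> int" where "superdiag k = (k, k + 1)"

lemma inj_diag: "inj diag"
  unfolding diag_def inj_def by auto

lemma matchings_empty:
  assumes "{} \<notin> E"
  shows "matchings E {} = {{}}"
proof -
  have "M = {}" if M: "M \<in> matchings E {}" for M
  proof (rule ccontr)
    assume "M \<noteq> {}"
    then obtain e where "e \<in> M" by blast
    then show False using matchings_edge[OF M] assms by auto
  qed
  moreover have "{} \<in> matchings E {}" unfolding matchings_def by simp
  ultimately show ?thesis by blast
qed

text \<open>
  In the strip, a vertex \<open>(k, k + 1)\<close> is adjacent to \<open>(k, k)\<close> and \<open>(k + 1, k + 1)\<close> only, as far as these
  belong to the strip. The partner of the last diagonal vertex \<open>(c, c)\<close> is forced: it is \<open>(c, c + 1)\<close> if that is present, since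
  this vertex has no other neighbour; otherwise \<open>(c - 1, c)\<close> if that is present, since pairing \<open>(c, c)\<close> with \<open>(c - 1, c - 1)\<close> would isolate it;
  and otherwise \<open>(c - 1, c - 1)\<close>. So the strip can be consumed from the end without any choice, and
  only the parity of its size matters.
\<close>
lemma strip_count:
  assumes "0 \<le> a" "a \<le> c + 1" "c \<le> 2 * int n" "I \<subseteq> {a - 1..c}" "I \<subseteq> {0..2 * int n - 1}"
  shows "card (matchings (EE n) (diag ` {a..c} \<union> superdiag ` I)) = (if even (c + 1 - a + int (card I)) then 1 else 0)"
  using assms
proof (induction "nat (c + 1 - a)" arbitrary: c I rule: less_induct)
  case less
  let ?E = "EE n" and ?W = "diag ` {a..c} \<union> superdiag ` I"
  have finI: "finite I" using less.prems(5) finite_subset by blast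
  have ddW: "(k, k) \<in> ?W \<longleftrightarrow> a \<le> k \<and> k \<le> c" for k unfolding diag_def superdiag_def by auto
  have eeW: "(k, k + 1) \<in> ?W \<longleftrightarrow> k \<in> I" for k unfolding diag_def superdiag_def by auto
  have onlyW: "(k, l) \<in> ?W \<Longrightarrow> l = k \<or> l = k + 1" for k l unfolding diag_def superdiag_def by auto
  consider "c = a - 1" | "a \<le> c" "c \<in> I" | "a \<le> c" "c \<notin> I" "c - 1 \<in> I" | "a \<le> c" "c \<notin> I" "c - 1 \<notin> I"
    using less.prems(2) by linarith
  then show ?case
  proof cases
    case 1
    then have I: "I \<subseteq> {a - 1}" using less.prems(4) by auto
    show ?thesis
    proof (cases "I = {}")
      case True
      then show ?thesis using 1 by (simp add: matchings_empty[OF EE_nonempty])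
    next
      case False
      then have I: "I = {a - 1}" using I by auto
      have W: "?W = {superdiag c}" using 1 I by simp
      have "matchings ?E {superdiag c} = {}"
      proof (rule ccontr)
        assume "matchings ?E {superdiag c} \<noteq> {}"
        then obtain M where M: "M \<in> matchings ?E {superdiag c}" by blast
        obtain e where e: "e \<in> ?E" "e \<subseteq> {superdiag c}" using matchings_cover[OF M, of "superdiag c"] by blast
        then have "card e \<le> card {superdiag c}" by (intro card_mono) auto
        then show False using card_EE[OF e(1)] by simp
      qed
      then show ?thesis using W 1 I by simp
    qed
  next
    case 2
    have "card (matchings ?E ?W) = card (matchings ?E (?W - {diag c, superdiag c}))"
    proof (rule card_matchings_forced)
      show "{diag c, superdiag c} \<in> ?E" unfolding diag_def superdiag_def
        using 2 less.prems by (intro vertical_edge) (auto, presburger?)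
      fix M assume M: "M \<in> matchings ?E ?W"
      obtain e where e: "e \<in> M" "superdiag c \<in> e" "e \<in> ?E" "e \<subseteq> ?W" using matchings_cover[OF M, of "superdiag c"] 2 by blast
      have e2: "(c, c + 1) \<in> e" using e(2) unfolding superdiag_def .
      have "(c + 1, c + 1) \<notin> e" using e(4) ddW[of "c + 1"] by auto
      moreover have "(c, c + 1 + 1) \<notin> e" using e(4) onlyW[of c "c + 1 + 1"] by auto
      ultimately have "e = {diag c, superdiag c}"
        using EE_at[OF e(3) e2] by (elim disjE conjE) (auto simp: diag_def superdiag_def)
      then show "{diag c, superdiag c} \<in> M" using e(1) by simp
    qed (use 2 card_EE in auto)
    also have "?W - {diag c, superdiag c} = diag ` {a..c - 1} \<union> superdiag ` (I - {c})"
      by (auto simp: diag_def superdiag_def)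
    also have "card (matchings ?E \<dots>) = (if even (c - 1 + 1 - a + int (card (I - {c}))) then 1 else 0)"
      using 2 less.prems by (intro less.hyps) auto
    also have "int (card (I - {c})) = int (card I) - 1"
      using card_Suc_Diff1[OF finI 2(2)] by linarith
    finally show ?thesis by (simp add: algebra_simps)
  next
    case 3
    have "card (matchings ?E ?W) = card (matchings ?E (?W - {superdiag (c - 1), diag c}))"
    proof (rule card_matchings_forced)
      have "{(c - 1, c), (c - 1 + 1, c)} \<in> ?E"
        using 3 less.prems by (intro horizontal_edge) auto
      then show "{superdiag (c - 1), diag c} \<in> ?E" unfolding diag_def superdiag_def by simp
      fix M assume M: "M \<in> matchings ?E ?W"
      obtain e where e: "e \<in> M" "diag c \<in> e" "e \<in> ?E" "e \<subseteq> ?W" using matchings_cover[OF M, of "diag c"] 3 by auto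
      obtain e' where e': "e' \<in> M" "superdiag (c - 1) \<in> e'" "e' \<in> ?E" "e' \<subseteq> ?W"
        using matchings_cover[OF M, of "superdiag (c - 1)"] 3 by blast
      have e2: "(c, c) \<in> e" using e(2) unfolding diag_def .
      have e2': "(c - 1, c) \<in> e'" using e'(2) unfolding superdiag_def by simp
      have no: "(c, c + 1) \<notin> e" "(c + 1, c + 1) \<notin> e" "(c, c - 1) \<notin> e"
        using e(4) ddW[of "c + 1"] eeW[of c] onlyW[of c "c - 1"] 3 by auto
      have no': "(c - 1, c + 1) \<notin> e'" using e'(4) onlyW[of "c - 1" "c + 1"] by auto
      have e'_cases: "e' = {(c - 1, c), (c, c)} \<or> e' = {(c - 1, c - 1), (c - 1, c)}"
        using EE_at[OF e'(3) e2'] no' by (elim disjE conjE) auto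
      have "e \<noteq> {(c - 1, c - 1), (c, c)}"
      proof
        assume ec: "e = {(c - 1, c - 1), (c, c)}"
        have "(c, c) \<in> e" "(c - 1, c - 1) \<in> e" unfolding ec by simp_all
        moreover have "(c, c) \<in> e' \<or> (c - 1, c - 1) \<in> e'" using e'_cases by blast
        ultimately have "e' = e" using matchings_unique[OF M e'(1) e(1)] by metis
        then show False using e2' unfolding ec by simp
      qed
      then have "e = {superdiag (c - 1), diag c}"
        using EE_at[OF e(3) e2] no by (elim disjE conjE) (auto simp: diag_def superdiag_def)
      then show "{superdiag (c - 1), diag c} \<in> M" using e(1) by simp
    qed (use 3 card_EE in auto)
    also have "?W - {superdiag (c - 1), diag c} = diag ` {a..c - 1} \<union> superdiag ` (I - {c - 1})"
      by (auto simp: diag_def superdiag_def)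
    also have "card (matchings ?E \<dots>) = (if even (c - 1 + 1 - a + int (card (I - {c - 1}))) then 1 else 0)"
    proof (intro less.hyps)
      show "I - {c - 1} \<subseteq> {a - 1..c - 1}"
      proof
        fix k assume "k \<in> I - {c - 1}"
        then have "k \<in> {a - 1..c}" "k \<noteq> c" using less.prems(4) 3 by auto
        then show "k \<in> {a - 1..c - 1}" by simp
      qed
    qed (use 3 less.prems in auto)
    also have "int (card (I - {c - 1})) = int (card I) - 1"
      using card_Suc_Diff1[OF finI 3(3)] by linarith
    finally show ?thesis by (simp add: algebra_simps)
  next
    case 4
    have Isub: "I \<subseteq> {a - 1..c - 2}"
    proof
      fix k assume "k \<in> I"
      then have "k \<in> {a - 1..c}" "k \<noteq> c" "k \<noteq> c - 1" using less.prems(4) 4 by auto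
      then show "k \<in> {a - 1..c - 2}" by simp
    qed
    have forced: "{diag (c - 1), diag c} \<in> M \<and> a \<le> c - 1" if M: "M \<in> matchings ?E ?W" for M
    proof -
      obtain e where e: "e \<in> M" "diag c \<in> e" "e \<in> ?E" "e \<subseteq> ?W" using matchings_cover[OF M, of "diag c"] 4 by auto
      have e2: "(c, c) \<in> e" using e(2) unfolding diag_def .
      have no: "(c, c + 1) \<notin> e" "(c + 1, c + 1) \<notin> e" "(c, c - 1) \<notin> e" "(c - 1, c) \<notin> e"
        using e(4) ddW[of "c + 1"] eeW[of c] eeW[of "c - 1"] onlyW[of c "c - 1"] 4 by auto
      have ec: "e = {(c - 1, c - 1), (c, c)}"
        using EE_at[OF e(3) e2] no by (elim disjE conjE) auto
      then have "(c - 1, c - 1) \<in> ?W" using e(4) by auto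
      then show ?thesis using e(1) ec ddW[of "c - 1"] unfolding diag_def by simp
    qed
    show ?thesis
    proof (cases "a = c")
      case True
      then have "matchings ?E ?W = {}" using forced by force
      moreover have "I = {}" using Isub True by auto
      ultimately show ?thesis using True by simp
    next
      case False
      have "card (matchings ?E ?W) = card (matchings ?E (?W - {diag (c - 1), diag c}))"
      proof (rule card_matchings_forced)
        have "{(c - 1, c - 1), (c - 1 + 1, c - 1 + 1)} \<in> ?E"
          using 4 False less.prems by (intro diagonal_edge) auto
        then show "{diag (c - 1), diag c} \<in> ?E" unfolding diag_def by simp
        show "diag (c - 1) \<in> ?W" "diag c \<in> ?W" using 4 False by auto
      qed (use forced card_EE in auto)
      also have "?W - {diag (c - 1), diag c} = diag ` {a..c - 2} \<union> superdiag ` I"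
        by (auto simp: diag_def superdiag_def)
      also have "card (matchings ?E \<dots>) = (if even (c - 2 + 1 - a + int (card I)) then 1 else 0)"
        using 4 False Isub less.prems by (intro less.hyps) auto
      finally show ?thesis by (simp add: algebra_simps)
    qed
  qed
qed

text \<open>
  Without \<open>(j, j)\<close> the vertices \<open>(j - 1, j)\<close> and \<open>(j, j + 1)\<close> belong to different components.
\<close>
lemma strip_split:
  assumes I: "I \<subseteq> {0..2 * int n - 1}" and a: "0 \<le> a" "a \<le> 1" and c: "2 * int n - 1 \<le> c" "c \<le> 2 * int n"
    and j: "1 \<le> j" "j \<le> 2 * int n - 1"
  shows "card (matchings (EE n) (diag ` ({a..c} - {j}) \<union> superdiag ` I)) =
    (if even (j - a + int (card (I \<inter> {..<j}))) \<and> even (c - j + int (card (I \<inter> {j..}))) then 1 else 0)"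
proof -
  let ?A = "diag ` {a..j - 1} \<union> superdiag ` (I \<inter> {..<j})" and ?B = "diag ` {j + 1..c} \<union> superdiag ` (I \<inter> {j..})"
  have "{a..c} - {j} = {a..j - 1} \<union> {j + 1..c}" using a c j by auto
  then have e1: "diag ` ({a..c} - {j}) = diag ` {a..j - 1} \<union> diag ` {j + 1..c}" by (simp only: image_Un)
  have "I = (I \<inter> {..<j}) \<union> (I \<inter> {j..})" by auto
  then have e2: "superdiag ` I = superdiag ` (I \<inter> {..<j}) \<union> superdiag ` (I \<inter> {j..})" by (metis image_Un)
  have W: "diag ` ({a..c} - {j}) \<union> superdiag ` I = ?A \<union> ?B" unfolding e1 e2 by blast
  have A: "(x, y) \<in> ?A \<longleftrightarrow> (y = x \<and> a \<le> x \<and> x < j) \<or> (y = x + 1 \<and> x \<in> I \<and> x < j)" for x y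
    unfolding diag_def superdiag_def by auto
  have B: "(x, y) \<in> ?B \<longleftrightarrow> (y = x \<and> j < x \<and> x \<le> c) \<or> (y = x + 1 \<and> x \<in> I \<and> j \<le> x)" for x y
    unfolding diag_def superdiag_def by auto
  have "card (matchings (EE n) (?A \<union> ?B)) = card (matchings (EE n) ?A) * card (matchings (EE n) ?B)"
  proof (rule card_matchings_separated)
    have "v \<notin> ?B" if "v \<in> ?A" for v
    proof (cases v)
      case (Pair x y)
      show ?thesis using that unfolding Pair A B by linarith
    qed
    then show "?A \<inter> ?B = {}" by blast
    show "{} \<notin> EE n" by (rule EE_nonempty)
    fix M e assume "M \<in> matchings (EE n) (?A \<union> ?B)" "e \<in> M"
    then have e: "e \<in> EE n" "e \<subseteq> ?A \<union> ?B" using matchings_edge by blast+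
    show "e \<subseteq> ?A \<or> e \<subseteq> ?B"
      using e(1)
    proof (cases rule: EE_cases)
      case (horizontal x y)
      have "(x, y) \<in> ?A \<or> (x, y) \<in> ?B" "(x + 1, y) \<in> ?A \<or> (x + 1, y) \<in> ?B" using e(2) unfolding horizontal(1) by auto
      moreover from this(1) have y: "y = x + 1" using horizontal(4) unfolding A B by auto
      ultimately have "(x, y) \<in> ?A \<and> (x + 1, y) \<in> ?A \<or> (x, y) \<in> ?B \<and> (x + 1, y) \<in> ?B"
        unfolding A B y by auto
      then show ?thesis unfolding horizontal(1) by auto
    next
      case (vertical x y)
      have "(x, y) \<in> ?A \<or> (x, y) \<in> ?B" "(x, y + 1) \<in> ?A \<or> (x, y + 1) \<in> ?B" using e(2) unfolding vertical(1) by auto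
      then have "(x, y) \<in> ?A \<and> (x, y + 1) \<in> ?A \<or> (x, y) \<in> ?B \<and> (x, y + 1) \<in> ?B"
        unfolding A B by (smt (verit))
      then show ?thesis unfolding vertical(1) by auto
    next
      case (diagonal x)
      have "(x, x) \<in> ?A \<or> (x, x) \<in> ?B" "(x + 1, x + 1) \<in> ?A \<or> (x + 1, x + 1) \<in> ?B" using e(2) unfolding diagonal(1) by auto
      then have "(x, x) \<in> ?A \<and> (x + 1, x + 1) \<in> ?A \<or> (x, x) \<in> ?B \<and> (x + 1, x + 1) \<in> ?B"
        unfolding A B by auto
      then show ?thesis unfolding diagonal(1) by auto
    qed
  qed
  moreover have "card (matchings (EE n) ?A) = (if even (j - 1 + 1 - a + int (card (I \<inter> {..<j}))) then 1 else 0)"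
    using I a j by (intro strip_count) auto
  moreover have "card (matchings (EE n) ?B) = (if even (c + 1 - (j + 1) + int (card (I \<inter> {j..}))) then 1 else 0)"
    using I c j by (intro strip_count) force+
  ultimately show ?thesis unfolding W by simp
qed

text \<open>
  Here \<open>c\<close> and \<open>c'\<close> are the two possible ends of the diagonal strip; which one occurs depends on the parity of \<open>n\<close> and
  on whether \<open>b\<close> is deleted, see \<open>Z_del_core\<close>. After cutting along the diagonal the identity holds term by term: the
  pieces on the left of \<open>(j, j)\<close> start at 1 and at 0 and so have sizes of opposite parity, and whenever the whole
  strip is matchable, the pieces on the right have the matching parities.
\<close>
lemma diagonal_sum:
  assumes c: "{c, c'} = {2 * int n - 1, 2 * int n}" and j: "1 \<le> j" "j \<le> 2 * int n - 1"
  defines "R \<equiv> core n - range diag"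
  shows "card (matchings (EE n) (diag ` {0..c} \<union> R)) =
     card (matchings (EE n) (diag ` ({1..c} - {j}) \<union> R)) + card (matchings (EE n) (diag ` ({0..c'} - {j}) \<union> R))"
proof -
  let ?F = "superdiag ` {0..2 * int n - 1}"
  have cc: "2 * int n - 1 \<le> c" "c \<le> 2 * int n" "2 * int n - 1 \<le> c'" "c' \<le> 2 * int n" "c' = 2 * int n - 1 \<and> c = 2 * int n \<or> c' = 2 * int n \<and> c = 2 * int n - 1"
    using c by (auto simp: doubleton_eq_iff)
  have cut: "card (matchings (EE n) (diag ` K \<union> R)) = (\<Sum>Y\<in>Pow ?F. card (matchings (EE n) (diag ` K \<union> Y)) * card (matchings (EE n) (R - Y)))" for K
  proof (rule card_matchings_cut)
    show "diag ` K \<inter> R = {}" unfolding R_def by auto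
    show "?F \<subseteq> R" unfolding R_def core_def diag_def superdiag_def tip_def by (auto simp: mem_VV)
    show "\<not> e \<subseteq> ?F" if "e \<in> EE n" for e
      using that by (rule EE_cases) (auto simp: superdiag_def)
    fix e assume e: "e \<in> EE n" "e \<inter> diag ` K \<noteq> {}" "e \<subseteq> diag ` K \<union> R"
    then obtain k where k: "k \<in> K" "(k, k) \<in> e" unfolding diag_def by auto
    have p: "tip n \<notin> e" using e(3) unfolding R_def core_def diag_def tip_def by auto
    have eV: "e \<subseteq> VV n" using EE_subset_VV[OF e(1)] .
    show "e \<subseteq> diag ` K \<union> ?F"
    proof
      fix v assume v: "v \<in> e"
      have "v \<in> range diag \<or> v \<in> ?F"
        using EE_at[OF e(1) k(2)]
      proof (elim disjE conjE)
        assume "e = {(k, k), (k, k + 1)}"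
        moreover from this have "0 \<le> k" "k \<le> 2 * int n" "k \<noteq> 2 * int n" using eV p unfolding tip_def by (auto simp: mem_VV)
        ultimately show ?thesis using v unfolding diag_def superdiag_def by auto
      next
        assume *: "e = {(k - 1, k), (k, k)}"
        then have "0 \<le> k - 1" "k \<le> 2 * int n" using eV by (auto simp: mem_VV)
        then have "superdiag (k - 1) \<in> ?F" by auto
        then show ?thesis using v * unfolding diag_def superdiag_def by auto
      next
        assume "e = {(k, k - 1), (k, k)}"
        then show ?thesis using eV by (auto simp: mem_VV)
      qed (use v in \<open>auto simp: diag_def\<close>)
      then show "v \<in> diag ` K \<union> ?F" using v e(3) unfolding R_def by auto
    qed
  qed (auto simp: finite_EE EE_nonempty)
  have main: "card (matchings (EE n) (diag ` {0..c} \<union> Y)) =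
     card (matchings (EE n) (diag ` ({1..c} - {j}) \<union> Y)) + card (matchings (EE n) (diag ` ({0..c'} - {j}) \<union> Y))" if "Y \<in> Pow ?F" for Y
  proof -
    obtain I where I: "I \<subseteq> {0..2 * int n - 1}" "Y = superdiag ` I" using \<open>Y \<in> Pow ?F\<close> by (meson PowD subset_imageE)
    have finI: "finite I" using I(1) finite_subset by blast
    have "I = (I \<inter> {..<j}) \<union> (I \<inter> {j..})" by auto
    then have "card I = card (I \<inter> {..<j}) + card (I \<inter> {j..})"
      using finI card_Un_disjoint[of "I \<inter> {..<j}" "I \<inter> {j..}"] by fastforce
    then have cI: "int (card I) = int (card (I \<inter> {..<j})) + int (card (I \<inter> {j..}))" by simp
    have 1: "card (matchings (EE n) (diag ` {0..c} \<union> superdiag ` I)) = (if even (c + 1 - 0 + int (card I)) then 1 else 0)"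
      using I cc by (intro strip_count) auto
    have 2: "card (matchings (EE n) (diag ` ({1..c} - {j}) \<union> superdiag ` I)) =
      (if even (j - 1 + int (card (I \<inter> {..<j}))) \<and> even (c - j + int (card (I \<inter> {j..}))) then 1 else 0)"
      by (rule strip_split[OF I(1) _ _ cc(1,2) j]) auto
    have 3: "card (matchings (EE n) (diag ` ({0..c'} - {j}) \<union> superdiag ` I)) =
      (if even (j - 0 + int (card (I \<inter> {..<j}))) \<and> even (c' - j + int (card (I \<inter> {j..}))) then 1 else 0)"
      by (rule strip_split[OF I(1) _ _ cc(3,4) j]) auto
    show ?thesis unfolding I(2) 1 2 3 cI using cc(5) by (elim disjE conjE; simp) argo+
  qed
  show ?thesis unfolding cut by (simp add: main distrib_right sum.distrib)
qed

lemma Z_del_diagonal_sum: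
  assumes j: "1 \<le> j" "j \<le> 2 * int n - 1"
  shows "Z_del n {} = Z_del n {(0, 0), (j, j)} + Z_del n {bvert n, (j, j)}"
proof -
  define R where "R = core n - range diag"
  let ?N = "2 * int n"
  have ddc: "diag k \<in> core n \<longleftrightarrow> 0 \<le> k \<and> k \<le> ?N" for k
    unfolding diag_def core_def tip_def by (auto simp: mem_VV)
  have W: "core n - diag ` X = diag ` ({0..?N} - X) \<union> R" for X
  proof -
    have "core n = diag ` {0..?N} \<union> R"
    proof
      show "core n \<subseteq> diag ` {0..?N} \<union> R" unfolding R_def using ddc by auto
      show "diag ` {0..?N} \<union> R \<subseteq> core n" unfolding R_def using ddc by auto
    qed
    then have "core n - diag ` X = (diag ` {0..?N} - diag ` X) \<union> (R - diag ` X)" by auto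
    also have "diag ` {0..?N} - diag ` X = diag ` ({0..?N} - X)" by (rule image_set_diff[OF inj_diag, symmetric])
    also have "R - diag ` X = R" unfolding R_def by auto
    finally show ?thesis .
  qed
  have t: "corner n = diag ?N" unfolding corner_def diag_def ..
  have out: "corner n \<notin> {(0, 0), (j, j)}" "tip n \<notin> {(0, 0), (j, j)}" "corner n \<notin> {(j, j)}" "tip n \<notin> {(j, j)}"
    using j unfolding corner_def tip_def by auto
  note N1 = Z_del_core(1)[of n "{}", simplified] and N2 = Z_del_core(1)[OF out(1,2)] and N3 = Z_del_core(2)[OF out(3,4)]
  have remove: "core n - A = diag ` K \<union> R" if "A = diag ` X" "{0..?N} - X = K" for A X K
    unfolding that(1) W that(2) ..
  have s1: "core n - {corner n} = diag ` {0..?N - 1} \<union> R" by (rule remove[of _ "{?N}"]) (auto simp: t)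
  have s2: "core n - {(0, 0), (j, j)} - {corner n} = diag ` ({1..?N - 1} - {j}) \<union> R"
    unfolding Diff_insert[symmetric] by (rule remove[of _ "{0, j, ?N}"]) (use j in \<open>auto simp: t diag_def\<close>)
  have s3: "core n - {(j, j)} = diag ` ({0..?N} - {j}) \<union> R" by (rule remove[of _ "{j}"]) (auto simp: diag_def)
  have s4: "core n = diag ` {0..?N} \<union> R" using remove[of "{}" "{}"] by simp
  have s5: "core n - {(0, 0), (j, j)} = diag ` ({1..?N} - {j}) \<union> R"
    by (rule remove[of _ "{0, j}"]) (use j in \<open>auto simp: diag_def\<close>)
  have s6: "core n - {(j, j)} - {corner n} = diag ` ({0..?N - 1} - {j}) \<union> R"
    unfolding Diff_insert[symmetric] by (rule remove[of _ "{j, ?N}"]) (use j in \<open>auto simp: t diag_def\<close>)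
  show ?thesis
  proof (cases "even n")
    case True
    have "{?N - 1, ?N} = {?N - 1, ?N}" ..
    from diagonal_sum[OF this j, folded R_def]
    show ?thesis unfolding N1 N2 N3 if_P[OF True] Diff_empty s1 s2 s3 .
  next
    case False
    have "{?N, ?N - 1} = {?N - 1, ?N}" by blast
    from diagonal_sum[OF this j, folded R_def]
    show ?thesis unfolding N1 N2 N3 if_not_P[OF False] s5 s6 using s4 by simp
  qed
qed

section \<open>A perfect matching of \<open>G\<^sub>n\<close>\<close>

lemma matchings_of_involution:
  assumes V: "\<And>v. v \<in> V \<Longrightarrow> f v \<in> V \<and> f (f v) = v \<and> {v, f v} \<in> E"
  shows "(\<lambda>v. {v, f v}) ` V \<in> matchings E V"
proof -
  have "\<exists>!e. e \<in> (\<lambda>v. {v, f v}) ` V \<and> v \<in> e" if v: "v \<in> V" for v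
  proof (rule ex1I[of _ "{v, f v}"])
    show "{v, f v} \<in> (\<lambda>v. {v, f v}) ` V \<and> v \<in> {v, f v}" using v by auto
    fix e assume "e \<in> (\<lambda>v. {v, f v}) ` V \<and> v \<in> e"
    then obtain u where u: "u \<in> V" "e = {u, f u}" "v = u \<or> v = f u" by auto
    then show "e = {v, f v}" using V[of u] by (auto simp: insert_commute)
  qed
  then show ?thesis unfolding matchings_def using V by auto
qed

text \<open>
  A pattern with period 4 in \<open>x\<close>: vertical edges from even to odd heights, except that
  for \<open>x = 1\<close> modulo 4 the two edges that join \<open>(x, x)\<close> with \<open>(x + 1, x + 1)\<close> and \<open>(x + 1, x + 2)\<close> with \<open>(x + 2, x + 2)\<close>
  repair the defect at the lower end of three consecutive columns.
\<close>
definition partner :: "int \<times> int \<Rightarrow> int \<times> int" where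
  "partner = (\<lambda>(x, y).
     if x mod 4 = 1 \<and> y = x then (x + 1, y + 1)
     else if x mod 4 = 2 \<and> y = x then (x - 1, y - 1)
     else if x mod 4 = 2 \<and> y = x + 1 then (x + 1, y)
     else if x mod 4 = 3 \<and> y = x then (x - 1, y)
     else if even y then (x, y + 1) else (x, y - 1))"

lemma Z_pos: "Z n > 0"
proof -
  have "partner v \<in> VV n \<and> partner (partner v) = v \<and> {v, partner v} \<in> EE n" if v: "v \<in> VV n" for v
  proof -
    obtain x y where xy: "v = (x, y)" by (cases v)
    have b: "0 \<le> x" "x \<le> 2 * int n" "x \<le> y" "y \<le> 2 * int n + 1" "\<not> (odd n \<and> x = 2 * int n \<and> y = 2 * int n + 1)"
      using v unfolding xy mem_VV by auto
    have lim: "x \<le> 2 * int n - int n mod 2" if "x = 2 * int n \<Longrightarrow> even n"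
    proof -
      have "int n mod 2 = (if even n then 0 else 1)" by presburger
      moreover have "x = 2 * int n \<or> x \<le> 2 * int n - 1" using b(2) by linarith
      ultimately show ?thesis using that by auto
    qed
    have "(x mod 4 = 1 \<and> y = x) \<or> (x mod 4 = 2 \<and> y = x) \<or> (x mod 4 = 2 \<and> y = x + 1) \<or> (x mod 4 = 3 \<and> y = x)
      \<or> (even y \<and> \<not> (x mod 4 = 2 \<and> y = x) \<and> (x < y \<or> x mod 4 = 0))
      \<or> (odd y \<and> x < y \<and> \<not> (x mod 4 = 2 \<and> y = x + 1))"
      using b(3) by presburger
    then consider
        "x mod 4 = 1" "y = x"
      | "x mod 4 = 2" "y = x"
      | "x mod 4 = 2" "y = x + 1"
      | "x mod 4 = 3" "y = x"
      | "even y" "\<not> (x mod 4 = 2 \<and> y = x)" "x < y \<or> x mod 4 = 0"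
      | "odd y" "x < y" "\<not> (x mod 4 = 2 \<and> y = x + 1)"
      by blast
    then show ?thesis
    proof cases
      case 1
      have p: "partner v = (x + 1, x + 1)" "partner (x + 1, x + 1) = v"
        using 1 unfolding xy partner_def by (simp_all, presburger+)
      have "x \<le> 2 * int n - 1" using 1 b(2) by presburger
      then have "{(x, x), (x + 1, x + 1)} \<in> EE n" using b by (intro diagonal_edge)
      moreover from EE_subset_VV[OF this] have "(x + 1, x + 1) \<in> VV n" by auto
      ultimately show ?thesis using p xy 1 by simp
    next
      case 2
      have p: "partner v = (x - 1, x - 1)" "partner (x - 1, x - 1) = v"
        using 2 unfolding xy partner_def by (simp_all, presburger+)
      have "0 \<le> x - 1" using 2 b(1) by presburger
      then have "{(x - 1, x - 1), (x - 1 + 1, x - 1 + 1)} \<in> EE n" using b by (intro diagonal_edge) auto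
      moreover from EE_subset_VV[OF this] have "(x - 1, x - 1) \<in> VV n" by auto
      ultimately show ?thesis using p xy 2 by (simp add: insert_commute)
    next
      case 3
      have p: "partner v = (x + 1, y)" "partner (x + 1, y) = v"
        using 3 unfolding xy partner_def by (simp_all, presburger+)
      have "x \<noteq> 2 * int n"
      proof
        assume "x = 2 * int n"
        then show False using b(5) 3 by presburger
      qed
      then have "{(x, y), (x + 1, y)} \<in> EE n" using b(1-4) 3 by (intro horizontal_edge; presburger)
      moreover from EE_subset_VV[OF this] have "(x + 1, y) \<in> VV n" by auto
      ultimately show ?thesis using p xy by simp
    next
      case 4
      have p: "partner v = (x - 1, y)" "partner (x - 1, y) = v"
        using 4 unfolding xy partner_def by (simp_all, presburger+)
      have "0 \<le> x - 1" using 4 b(1) by presburger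
      then have "{(x - 1, y), (x - 1 + 1, y)} \<in> EE n" using b 4 by (intro horizontal_edge) (simp_all, presburger?)
      moreover from EE_subset_VV[OF this] have "(x - 1, y) \<in> VV n" by auto
      ultimately show ?thesis using p xy by (simp add: insert_commute)
    next
      case 5
      have "y \<noteq> x + 1 \<or> x mod 4 \<noteq> 2" "\<not> (x mod 4 = 1 \<and> y = x)" "\<not> (x mod 4 = 3 \<and> y = x)" using 5 by presburger+
      then have p: "partner v = (x, y + 1)" using 5 unfolding xy partner_def by auto
      have "\<not> (x mod 4 = 2 \<and> y + 1 = x + 1)" using 5 by presburger
      then have p2: "partner (x, y + 1) = v" using 5 b(3) unfolding xy partner_def by auto
      have "y \<le> 2 * int n" using 5 b(4) by presburger
      moreover have "x \<le> 2 * int n - int n mod 2"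
      proof (rule lim)
        assume x: "x = 2 * int n"
        then have "x mod 4 = 0" using 5(3) b(3) \<open>y \<le> 2 * int n\<close> by linarith
        then show "even n" using x by presburger
      qed
      ultimately have "{(x, y), (x, y + 1)} \<in> EE n" using b by (intro vertical_edge)
      moreover from EE_subset_VV[OF this] have "(x, y + 1) \<in> VV n" by auto
      ultimately show ?thesis using p p2 xy by simp
    next
      case 6
      have p: "partner v = (x, y - 1)" using 6 unfolding xy partner_def by auto
      have "\<not> (x mod 4 = 2 \<and> y - 1 = x)" "\<not> (x mod 4 = 1 \<and> y - 1 = x)" "\<not> (x mod 4 = 3 \<and> y - 1 = x)"
        "\<not> (x mod 4 = 2 \<and> y - 1 = x + 1)" using 6 by presburger+
      then have p2: "partner (x, y - 1) = v" using 6 unfolding xy partner_def by auto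
      have "x \<le> 2 * int n - int n mod 2" using 6(2) b(4,5) by (intro lim) auto
      then have "{(x, y - 1), (x, y - 1 + 1)} \<in> EE n" using b 6 by (intro vertical_edge) auto
      moreover from EE_subset_VV[OF this] have "(x, y - 1) \<in> VV n" by auto
      ultimately show ?thesis using p p2 xy by (simp add: insert_commute)
    qed
  qed
  then have "matchings (EE n) (VV n) \<noteq> {}" using matchings_of_involution[of "VV n" partner "EE n"] by blast
  then show ?thesis unfolding Z_eq_matchings using finite_matchings[OF finite_EE] by (simp add: card_gt_0_iff)
qed

section \<open>The recursion for the quotients\<close>

text \<open>
  On the boundary of \<open>G\<^sub>m\<close> the cyclic order is: left column, diagonal from left to right, \<open>b\<close>.
\<close>
lemma Z_del_condensation:
  assumes ij: "0 \<le> i" "i < j" "j \<le> 2 * int m - 1" and u: "(0, y) \<in> VV m" "y \<noteq> 0 \<or> i \<noteq> 0"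
  shows "Z_del m {} * Z_del m {(0, y), (i, i), (j, j), bvert m} + Z_del m {(0, y), (j, j)} * Z_del m {(i, i), bvert m}
    = Z_del m {(0, y), (i, i)} * Z_del m {(j, j), bvert m} + Z_del m {(0, y), bvert m} * Z_del m {(i, i), (j, j)}"
proof -
  obtain z where z: "bvert m = (2 * int m, z)" "(2 * int m, z) \<in> VV m"
    using corner_in[of m] tip_in[of m] unfolding bvert_eq corner_def tip_def by (cases "even m") auto
  have "0 \<le> y" "y \<le> 2 * int m + 1" using u(1) by (auto simp: mem_VV)
  moreover have "(i, i) \<in> VV m" "(j, j) \<in> VV m" using ij by (auto simp: mem_VV)
  ultimately have V: "{(0, y), (i, i), (j, j), (2 * int m, z)} \<subseteq> VV m" and y: "0 \<le> y" "y \<le> 2 * int m + 1"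
    using u(1) z(2) by simp_all
  have dist: "distinct [(0, y), (i, i), (j, j), (2 * int m, z)]" using ij u(2) by auto
  have planar: False if "P \<subseteq> EE m" "Q \<subseteq> EE m" "\<Union>P \<inter> \<Union>Q = {}" "odd_verts P = {(0, y), (j, j)}"
    "odd_verts Q = {(i, i), (2 * int m, z)}" for P Q
    using noncrossing[OF that y ij] .
  show ?thesis
    unfolding Z_del_eq_matchings z(1) Diff_empty by (rule condensation[OF finite_EE card_EE dist V planar])
qed

text \<open>
  The gate of \<open>G\<^bsub>m+1\<^esub>\<close> in the coordinates of \<open>G\<^sub>m\<close>.
\<close>
definition inner_gate :: "nat \<Rightarrow> (int \<times> int) set" where
  "inner_gate m = {(x, y). x = 0 \<and> 0 \<le> y \<and> y \<le> 2 * int m \<and> even y}"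

lemma shift_inner_gate: "shift ` inner_gate m = gate (Suc m)"
proof (intro set_eqI iffI)
  fix v assume "v \<in> shift ` inner_gate m" then show "v \<in> gate (Suc m)" unfolding inner_gate_def gate_def by auto
next
  fix v assume v: "v \<in> gate (Suc m)"
  obtain x y where xy: "v = (x, y)" by (cases v)
  have "y \<le> 2 * int (Suc m)" using v unfolding xy gate_def by auto presburger
  then have "(x - 2, y - 2) \<in> inner_gate m" using v unfolding xy gate_def inner_gate_def by auto
  then have "shift (x - 2, y - 2) \<in> shift ` inner_gate m" by (rule imageI)
  then show "v \<in> shift ` inner_gate m" unfolding xy by simp
qed

text \<open>
  The weights are the same in both formulas and for all \<open>S\<close>, which makes relations among the
  numbers for \<open>m\<close> carry over to \<open>m + 1\<close>.
\<close>
lemma Z_del_recursion: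
  assumes m: "m \<ge> 1" and S: "corner m \<notin> S" "tip m \<notin> S" "S \<subseteq> core m"
  shows "Z_del (Suc m) (shift ` S) =
      (\<Sum>u\<in>inner_gate m. left_weight (Suc m) (shift u) * (if u \<in> S then 0 else Z_del m (insert (bvert m) (insert u S))))"
    and "Z_del (Suc m) (insert (bvert (Suc m)) (shift ` S)) =
      (\<Sum>u\<in>inner_gate m. left_weight (Suc m) (shift u) * (if u \<in> S then 0 else Z_del m (insert u S)))"
proof -
  have fin: "finite (inner_gate m)" using finite_imageD[of shift "inner_gate m"] finite_gate[of "Suc m"] inj_shift
    unfolding shift_inner_gate by (simp add: inj_on_subset)
  have u: "corner m \<notin> insert u S" "tip m \<notin> insert u S" "insert u S \<subseteq> core m" if "u \<in> inner_gate m" for u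
    using S m that unfolding inner_gate_def corner_def tip_def core_def by (auto simp: mem_VV)
  have fstS: "2 \<le> fst v" if "v \<in> shift ` S" for v
    using that S(3) unfolding core_def shift_def by (auto simp: mem_VV)
  have gS: "gate (Suc m) - shift ` S = shift ` (inner_gate m - S)"
    unfolding shift_inner_gate[symmetric] image_set_diff[OF inj_shift] ..
  have red: "(\<Sum>v\<in>gate (Suc m) - shift ` S. left_weight (Suc m) v * f v) =
    (\<Sum>u\<in>inner_gate m. left_weight (Suc m) (shift u) * (if u \<in> S then 0 else h u))"
    if fh: "\<And>u. u \<in> inner_gate m \<Longrightarrow> f (shift u) = h u" for f h
  proof -
    have "(\<Sum>v\<in>gate (Suc m) - shift ` S. left_weight (Suc m) v * f v) = (\<Sum>u\<in>inner_gate m - S. left_weight (Suc m) (shift u) * f (shift u))"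
      unfolding gS by (subst sum.reindex) (auto simp: inj_on_subset[OF inj_shift])
    also have "\<dots> = (\<Sum>u\<in>inner_gate m. left_weight (Suc m) (shift u) * (if u \<in> S then 0 else h u))"
      using fin by (intro sum.mono_neutral_cong_left) (auto simp: fh)
    finally show ?thesis .
  qed
  have "Z_del (Suc m) (shift ` S) = (\<Sum>v\<in>gate (Suc m) - shift ` S. left_weight (Suc m) v * card (matchings (EE (Suc m)) (right_part (Suc m) - insert v (shift ` S))))"
    using fstS by (intro Z_del_cut_after_column_1) auto
  also have "\<dots> = (\<Sum>u\<in>inner_gate m. left_weight (Suc m) (shift u) * (if u \<in> S then 0 else Z_del m (insert (bvert m) (insert u S))))"
  proof (rule red)
    fix u assume "u \<in> inner_gate m"
    from Z_del_right_part(1)[OF u[OF this]]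
    show "card (matchings (EE (Suc m)) (right_part (Suc m) - insert (shift u) (shift ` S))) = Z_del m (insert (bvert m) (insert u S))" by simp
  qed
  finally show "Z_del (Suc m) (shift ` S) =
      (\<Sum>u\<in>inner_gate m. left_weight (Suc m) (shift u) * (if u \<in> S then 0 else Z_del m (insert (bvert m) (insert u S))))" .
  have bg: "bvert (Suc m) \<notin> gate (Suc m)" using m unfolding bvert_def gate_def by auto
  have "Z_del (Suc m) (insert (bvert (Suc m)) (shift ` S)) = (\<Sum>v\<in>gate (Suc m) - insert (bvert (Suc m)) (shift ` S). left_weight (Suc m) v * card (matchings (EE (Suc m)) (right_part (Suc m) - insert v (insert (bvert (Suc m)) (shift ` S)))))"
    using fstS by (intro Z_del_cut_after_column_1) (auto simp: bvert_def)
  also have "gate (Suc m) - insert (bvert (Suc m)) (shift ` S) = gate (Suc m) - shift ` S" using bg by auto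
  also have "(\<Sum>v\<in>gate (Suc m) - shift ` S. left_weight (Suc m) v * card (matchings (EE (Suc m)) (right_part (Suc m) - insert v (insert (bvert (Suc m)) (shift ` S)))))
    = (\<Sum>u\<in>inner_gate m. left_weight (Suc m) (shift u) * (if u \<in> S then 0 else Z_del m (insert u S)))"
  proof (rule red)
    fix u assume "u \<in> inner_gate m"
    from Z_del_right_part(2)[OF u[OF this]]
    show "card (matchings (EE (Suc m)) (right_part (Suc m) - insert (shift u) (insert (bvert (Suc m)) (shift ` S)))) = Z_del m (insert u S)"
      by (simp add: insert_commute)
  qed
  finally show "Z_del (Suc m) (insert (bvert (Suc m)) (shift ` S)) =
      (\<Sum>u\<in>inner_gate m. left_weight (Suc m) (shift u) * (if u \<in> S then 0 else Z_del m (insert u S)))" .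
qed

text \<open>
  Sum \<open>Z_del_condensation\<close> over \<open>u\<close>. The vertex \<open>u = (0, 0)\<close> coincides with \<open>(i, i)\<close> if \<open>i = 0\<close>; then two of the four terms
  vanish and the other two agree.
\<close>
lemma Z_del_bulk:
  assumes ij: "0 \<le> i" "i < j" "j \<le> 2 * int m - 1"
  shows "Z_del m {} * Z_del (Suc m) {(i + 2, i + 2), (j + 2, j + 2)} + Z_del (Suc m) {bvert (Suc m), (j + 2, j + 2)} * Z_del m {(i, i), bvert m}
    = Z_del (Suc m) {bvert (Suc m), (i + 2, i + 2)} * Z_del m {(j, j), bvert m} + Z_del (Suc m) {} * Z_del m {(i, i), (j, j)}"
proof -
  have m: "m \<ge> 1" using ij by linarith
  let ?I = "(i, i)" and ?J = "(j, j)" and ?b = "bvert m"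
  let ?w = "\<lambda>u. left_weight (Suc m) (shift u)"
  have out: "corner m \<notin> {?I, ?J}" "tip m \<notin> {?I, ?J}" "{?I, ?J} \<subseteq> core m"
    using ij unfolding corner_def tip_def core_def by (auto simp: mem_VV)
  have A: "Z_del (Suc m) {(i + 2, i + 2), (j + 2, j + 2)} = (\<Sum>u\<in>inner_gate m. ?w u * (if u \<in> {?I, ?J} then 0 else Z_del m (insert ?b (insert u {?I, ?J}))))"
    using Z_del_recursion(1)[OF m out] by simp
  have B: "Z_del (Suc m) {bvert (Suc m), (k + 2, k + 2)} = (\<Sum>u\<in>inner_gate m. ?w u * (if u \<in> {(k, k)} then 0 else Z_del m (insert u {(k, k)})))"
    if "k = i \<or> k = j" for k
    using Z_del_recursion(2)[OF m, of "{(k, k)}"] out that by auto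
  have C: "Z_del (Suc m) {} = (\<Sum>u\<in>inner_gate m. ?w u * Z_del m {?b, u})"
    using Z_del_recursion(1)[OF m, of "{}"] by simp
  have pointwise: "Z_del m {} * (if u \<in> {?I, ?J} then 0 else Z_del m (insert ?b (insert u {?I, ?J}))) + (if u \<in> {?J} then 0 else Z_del m (insert u {?J})) * Z_del m {?I, ?b}
    = (if u \<in> {?I} then 0 else Z_del m (insert u {?I})) * Z_del m {?J, ?b} + Z_del m {?b, u} * Z_del m {?I, ?J}"
    if u: "u \<in> inner_gate m" for u
  proof -
    obtain y where y: "u = (0, y)" "0 \<le> y" "y \<le> 2 * int m" using u unfolding inner_gate_def by auto
    have uJ: "u \<noteq> ?J" using ij y by auto
    show ?thesis
    proof (cases "u = ?I")
      case True
      then show ?thesis using uJ by (simp add: insert_commute)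
    next
      case False
      then have "(0, y) \<in> VV m" "y \<noteq> 0 \<or> i \<noteq> 0" using y m by (auto simp: mem_VV)
      from Z_del_condensation[OF ij this, folded y(1)]
      have "Z_del m {} * Z_del m {?b, u, ?I, ?J} + Z_del m {u, ?J} * Z_del m {?I, ?b} = Z_del m {u, ?I} * Z_del m {?J, ?b} + Z_del m {?b, u} * Z_del m {?I, ?J}"
        by (simp only: insert_commute)
      moreover have "u \<notin> {?I, ?J}" "u \<notin> {?I}" "u \<notin> {?J}" using False uJ by auto
      ultimately show ?thesis by (simp only: if_False)
    qed
  qed
  have "Z_del m {} * Z_del (Suc m) {(i + 2, i + 2), (j + 2, j + 2)} + Z_del (Suc m) {bvert (Suc m), (j + 2, j + 2)} * Z_del m {?I, ?b}
    = (\<Sum>u\<in>inner_gate m. ?w u * (Z_del m {} * (if u \<in> {?I, ?J} then 0 else Z_del m (insert ?b (insert u {?I, ?J}))) + (if u \<in> {?J} then 0 else Z_del m (insert u {?J})) * Z_del m {?I, ?b}))"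
    unfolding A B[OF disjI2[OF refl]] sum_distrib_left sum_distrib_right sum.distrib[symmetric]
    by (rule sum.cong) (simp_all only: algebra_simps)
  also have "\<dots> = (\<Sum>u\<in>inner_gate m. ?w u * ((if u \<in> {?I} then 0 else Z_del m (insert u {?I})) * Z_del m {?J, ?b} + Z_del m {?b, u} * Z_del m {?I, ?J}))"
    by (rule sum.cong) (simp_all only: pointwise)
  also have "\<dots> = Z_del (Suc m) {bvert (Suc m), (i + 2, i + 2)} * Z_del m {?J, ?b} + Z_del (Suc m) {} * Z_del m {?I, ?J}"
    unfolding B[OF disjI1[OF refl]] C sum_distrib_left sum_distrib_right sum.distrib[symmetric]
    by (rule sum.cong) (simp_all only: algebra_simps)
  finally show ?thesis .
qed

theorem theorem8p2:
  fixes n :: nat and i j :: int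
  assumes "n \<ge> 1" and "0 \<le> i" and "i < j" and "j \<le> 2 * int n - 1"
  shows "(i = 0 \<and> j > 0 \<longrightarrow> g n i j = 1 - gb n j)
    \<and> (i = 1 \<and> j > 1 \<longrightarrow> g n i j = real (Z (n - 1)) / real (Z n) * gb (n - 1) (j - 2))
    \<and> (i \<ge> 2 \<and> j \<ge> 2 \<longrightarrow>
         g n i j = g (n - 1) (i - 2) (j - 2)
                   - gb n j * gb (n - 1) (i - 2)
                   + gb n i * gb (n - 1) (j - 2))"
proof -
  obtain m where n: "n = Suc m" using assms(1) by (cases n) auto
  have Z: "Z k = Z_del k {}" for k unfolding Z_eq_matchings Z_del_eq_matchings by simp
  have pos: "real (Z k) > 0" for k using Z_pos by simp
  have first: "g n i j = 1 - gb n j" if "i = 0"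
  proof -
    have "Z n = Z_del n {(0, 0), (j, j)} + Z_del n {(j, j), bvert n}"
      unfolding Z using Z_del_diagonal_sum[of j n] assms that by (simp add: insert_commute)
    then show ?thesis using pos[of n] assms that unfolding g_def gb_def by (simp add: field_simps)
  qed
  have second: "g n i j = real (Z (n - 1)) / real (Z n) * gb (n - 1) (j - 2)" if "i = 1"
  proof -
    have J: "corner m \<notin> {(j - 2, j - 2)}" "tip m \<notin> {(j - 2, j - 2)}" "{(j - 2, j - 2)} \<subseteq> core m" "{(j, j)} \<subseteq> right_part n"
      using assms that n unfolding corner_def tip_def core_def right_part_def by (auto simp: mem_VV)
    have "Z_del n {(1, 1), (j, j)} = card (matchings (EE n) (right_part n - {(j, j)}))"
      using Z_del_frozen_columns[OF assms(1) J(4)] .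
    also have "\<dots> = Z_del m {(j - 2, j - 2), bvert m}"
      using Z_del_right_part(1)[OF J(1-3)] n by (simp add: insert_commute)
    finally show ?thesis using pos[of n] pos[of m] assms that n unfolding g_def gb_def by simp
  qed
  have third: "g n i j = g (n - 1) (i - 2) (j - 2) - gb n j * gb (n - 1) (i - 2) + gb n i * gb (n - 1) (j - 2)" if "i \<ge> 2"
  proof -
    have "Z m * Z_del n {(i, i), (j, j)} + Z_del n {(j, j), bvert n} * Z_del m {(i - 2, i - 2), bvert m}
      = Z_del n {(i, i), bvert n} * Z_del m {(j - 2, j - 2), bvert m} + Z n * Z_del m {(i - 2, i - 2), (j - 2, j - 2)}"
      unfolding Z using Z_del_bulk[of "i - 2" "j - 2" m] assms that n by (simp add: insert_commute)
    then have "real (Z m) * real (Z_del n {(i, i), (j, j)}) + real (Z_del n {(j, j), bvert n}) * real (Z_del m {(i - 2, i - 2), bvert m})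
      = real (Z_del n {(i, i), bvert n}) * real (Z_del m {(j - 2, j - 2), bvert m}) + real (Z n) * real (Z_del m {(i - 2, i - 2), (j - 2, j - 2)})"
      unfolding of_nat_mult[symmetric] of_nat_add[symmetric] of_nat_eq_iff .
    moreover have "x / zn = t / zm - p / zn * (q / zm) + r / zn * (s / zm)"
      if "zm * x + p * q = r * s + zn * t" "zm > 0" "zn > 0" for zm zn x p q r s t :: real
      using that by (simp add: field_simps)
    ultimately show ?thesis using pos[of n] pos[of m] assms(3) n unfolding g_def gb_def by simp
  qed
  show ?thesis using first second third by blast
qed

end
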